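(* Let $X$ be a compact well-ordered space whose limit capacity is a successor ordinal. Then the homeomorphism group $\mathrm{Homeo}(X)$, regarded as an abstract group, is SB-generated.
   Context: A well-ordered space is a well-ordered set with its order topology. For a space $X$, set $X^{(0)}=X$, $X^{(\alpha+1)}$ the set of accumulation points of $X^{(\alpha)}$, and $X^{(\lambda)}=\bigcap_{\alpha<\lambda}X^{(\alpha)}$ for limit $\lambda$; the Cantor--Bendixson rank is the least $\alpha$ with $X^{(\alpha+1)}=X^{(\alpha)}$. For a compact well-ordered space this rank is a successor ordinal, and its predecessor is called the limit capacity. A subset of a group $G$ is strongly bounded if it has finite diameter in every left-invariant metric on $G$; a group is SB-generated if generated by a strongly bounded subset. *)

theory Defs
  imports "HOL-Analysis.Analysis" "HOL-Algebra.Generated_Groups"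
begin

text \<open>Elements of a well-ordered index type stand for the ordinals below its order type.
  j is the immediate predecessor of i.\<close>
definition wo_succ :: "'i::wellorder \<Rightarrow> 'i \<Rightarrow> bool" where
  "wo_succ j i \<longleftrightarrow> j < i \<and> (\<forall>k. j < k \<longrightarrow> i \<le> k)"

text \<open>Cantor--Bendixson derivatives of the whole space, indexed by the well-order:
  X^(i) = accumulation points of X^(j) if i is the successor of j, and
  X^(i) = intersection of all X^(j), j < i, otherwise (this gives X at the least index).\<close>
definition cb_deriv_seq :: "('i::wellorder \<Rightarrow> 'a::topological_space set) \<Rightarrow> bool" where
  "cb_deriv_seq f \<longleftrightarrow>
     (\<forall>i. (\<forall>j. wo_succ j i \<longrightarrow> f i = {x. x islimpt f j}) \<and>
          ((\<nexists>j. wo_succ j i) \<longrightarrow> f i = (\<Inter>j\<in>{j. j < i}. f j)))"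

definition cb_rank_is :: "('i::wellorder \<Rightarrow> 'a::topological_space set) \<Rightarrow> 'i \<Rightarrow> bool" where
  "cb_rank_is f r \<longleftrightarrow>
     (\<exists>s. wo_succ r s \<and> f s = f r) \<and>
     (\<forall>a s. wo_succ a s \<and> f s = f a \<longrightarrow> r \<le> a)"

definition limit_capacity_is :: "('i::wellorder \<Rightarrow> 'a::topological_space set) \<Rightarrow> 'i \<Rightarrow> bool" where
  "limit_capacity_is f b \<longleftrightarrow> (\<exists>r. wo_succ b r \<and> cb_rank_is f r)"

definition left_invariant_metric :: "('g, 'b) monoid_scheme \<Rightarrow> ('g \<Rightarrow> 'g \<Rightarrow> real) \<Rightarrow> bool" where
  "left_invariant_metric G d \<longleftrightarrow>
     (\<forall>x\<in>carrier G. \<forall>y\<in>carrier G. d x y = 0 \<longleftrightarrow> x = y) \<and>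
     (\<forall>x\<in>carrier G. \<forall>y\<in>carrier G. d x y = d y x) \<and>
     (\<forall>x\<in>carrier G. \<forall>y\<in>carrier G. \<forall>z\<in>carrier G. d x z \<le> d x y + d y z) \<and>
     (\<forall>g\<in>carrier G. \<forall>x\<in>carrier G. \<forall>y\<in>carrier G. d (g \<otimes>\<^bsub>G\<^esub> x) (g \<otimes>\<^bsub>G\<^esub> y) = d x y)"

definition strongly_bounded :: "('g, 'b) monoid_scheme \<Rightarrow> 'g set \<Rightarrow> bool" where
  "strongly_bounded G A \<longleftrightarrow> A \<subseteq> carrier G \<and>
     (\<forall>d. left_invariant_metric G d \<longrightarrow> (\<exists>M. \<forall>x\<in>A. \<forall>y\<in>A. d x y \<le> M))"

definition SB_generated :: "('g, 'b) monoid_scheme \<Rightarrow> bool" where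
  "SB_generated G \<longleftrightarrow> (\<exists>A. strongly_bounded G A \<and> generate G A = carrier G)"

definition Homeo :: "('a::topological_space \<Rightarrow> 'a) monoid" where
  "Homeo = \<lparr> carrier = {h. \<exists>g. homeomorphism UNIV UNIV h g}, mult = (\<circ>), one = id \<rparr>"

end

theory Submission
  imports Defs "HOL-Real_Asymp.Real_Asymp"
begin

text \<open>Let \<open>C\<close> be the derivative of \<open>X\<close> whose set \<open>E\<close> of accumulation points is the last nonempty
  derivative; \<open>E\<close> is finite. Comparability of well-orders shows that two clopen sets containing the
  same finite nonzero number of points of \<open>C\<close>, and none of \<open>E\<close>, are homeomorphic. Hence \<open>X\<close> splits
  into clopen sets \<open>Y e\<close>, \<open>e \<in> E\<close>, such that \<open>Y e - {e}\<close> is a disjoint union of a sequence of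
  pairwise homeomorphic clopen pieces that converges to \<open>e\<close>; here the successor hypothesis enters.

  An infinite swindle writes any sequence of homeomorphisms supported on an infinite, co-infinite
  union of pieces of \<open>Y e\<close> as words of linearly growing length in three fixed letters. A
  left-invariant metric in which such homeomorphisms were unbounded would see a sequence of
  quadratically growing norm, so they form a strongly bounded set, and every homeomorphism supported
  on \<open>Y e\<close> is a product of three of them. Finally, Homeo(X) is generated by the homeomorphisms
  supported on a single \<open>Y e\<close> and finitely many further elements: representatives of the
  permutations induced on \<open>E\<close>, and shifts that move one piece from a fixed \<open>Y e0\<close> to another
  \<open>Y e\<close>.\<close>

section \<open>Homeomorphisms between open sets\<close>

definition open_homeo ::
    "'a::topological_space set \<Rightarrow> 'b::topological_space set \<Rightarrow> ('a \<Rightarrow> 'b) \<Rightarrow> bool" where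
  "open_homeo S T h \<longleftrightarrow> open S \<and> open T \<and> (\<exists>g. homeomorphism S T h g)"

lemma open_homeo_homeomorphism_inv_into:
  assumes "open_homeo S T h"
  shows "homeomorphism S T h (inv_into S h)"
proof -
  obtain g where g: "homeomorphism S T h g"
    using assms unfolding open_homeo_def by blast
  have "inv_into S h y = g y" if "y \<in> T" for y
    using g that unfolding homeomorphism_def
    by (intro inv_into_f_eq) (auto intro: inj_on_inverseI)
  then show ?thesis using homeomorphism_cong[OF g] by blast
qed

lemma open_homeoD:
  assumes "open_homeo S T h"
  shows "open S" "open T" "bij_betw h S T" "inj_on h S" "h ` S = T" "continuous_on S h"
    "\<And>x. x \<in> S \<Longrightarrow> h x \<in> T" "\<And>U. U \<subseteq> S \<Longrightarrow> open U \<Longrightarrow> open (h ` U)"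
proof -
  obtain g where g: "homeomorphism S T h g" and op: "open S" "open T"
    using assms unfolding open_homeo_def by blast
  show "open S" "open T" by (fact op)+
  show "inj_on h S" and "h ` S = T" "continuous_on S h" "\<And>x. x \<in> S \<Longrightarrow> h x \<in> T"
    using g unfolding homeomorphism_def by (auto intro: inj_on_inverseI)
  then show "bij_betw h S T" by (simp add: bij_betw_def)
  show "open (h ` U)" if "U \<subseteq> S" "open U" for U
    using homeomorphism_imp_open_map[OF g, of U] that op by (simp add: openin_open_eq)
qed

lemma open_homeo_iff_continuous_on:
  "open_homeo S T h \<longleftrightarrow> open S \<and> open T \<and> bij_betw h S T \<and>
     continuous_on S h \<and> continuous_on T (inv_into S h)" (is "_ \<longleftrightarrow> ?R")
proof
  assume h: "open_homeo S T h"
  then show ?R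
    using open_homeoD[OF h] homeomorphism_cont2[OF open_homeo_homeomorphism_inv_into[OF h]] by blast
next
  assume R: ?R
  then have "homeomorphism S T h (inv_into S h)"
    by (auto simp: homeomorphism_def bij_betw_def)
  then show "open_homeo S T h" using R unfolding open_homeo_def by blast
qed

lemma open_homeo_cong:
  assumes "open_homeo S T h" "\<And>x. x \<in> S \<Longrightarrow> h' x = h x"
  shows "open_homeo S T h'"
  using open_homeoD(1,2)[OF assms(1)]
    homeomorphism_cong[OF open_homeo_homeomorphism_inv_into[OF assms(1)] refl refl assms(2) refl]
  unfolding open_homeo_def by blast

lemma open_homeo_id: "open S \<Longrightarrow> open_homeo S S id"
  using homeomorphism_ident[of S] unfolding open_homeo_def id_def by blast

lemma open_homeo_comp: "open_homeo S T h \<Longrightarrow> open_homeo T R g \<Longrightarrow> open_homeo S R (g \<circ> h)"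
  unfolding open_homeo_def by (auto dest: homeomorphism_compose)

lemma open_homeo_inv_into: "open_homeo S T h \<Longrightarrow> open_homeo T S (inv_into S h)"
  using open_homeo_homeomorphism_inv_into[of S T h] open_homeoD(1,2)[of S T h]
  unfolding open_homeo_def homeomorphism_sym[of T] by blast

lemma open_homeo_subset:
  assumes "open_homeo S T h" "U \<subseteq> S" "open U"
  shows "open_homeo U (h ` U) h"
  using homeomorphism_of_subsets[OF open_homeo_homeomorphism_inv_into[OF assms(1)] assms(2) _ refl]
    open_homeoD(5,8)[OF assms(1)] assms(2,3)
  unfolding open_homeo_def by blast

lemma open_homeo_UN:
  assumes h: "\<And>i. i \<in> I \<Longrightarrow> open_homeo (S i) (T i) h"
    and disj: "disjoint_family_on T I"
  shows "open_homeo (\<Union>i\<in>I. S i) (\<Union>i\<in>I. T i) h"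
  unfolding open_homeo_iff_continuous_on
proof (intro conjI)
  show bij: "bij_betw h (\<Union>i\<in>I. S i) (\<Union>i\<in>I. T i)"
    using disj open_homeoD(3)[OF h] by (rule bij_betw_UNION_disjoint)
  show "continuous_on (\<Union>i\<in>I. T i) (inv_into (\<Union>i\<in>I. S i) h)"
  proof (rule continuous_on_open_UN)
    fix i assume i: "i \<in> I"
    show "open (T i)" using open_homeoD(2)[OF h[OF i]] .
    have "inv_into (\<Union>i\<in>I. S i) h y = inv_into (S i) h y" if "y \<in> T i" for y
      using that i bij inv_into_into[of y h "S i"] open_homeoD(5)[OF h[OF i]]
      by (intro inv_into_f_eq) (auto simp: bij_betw_def f_inv_into_f)
    then show "continuous_on (T i) (inv_into (\<Union>i\<in>I. S i) h)"
      using h[OF i] by (simp add: open_homeo_iff_continuous_on cong: continuous_on_cong)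
  qed
  show "continuous_on (\<Union>i\<in>I. S i) h"
    using open_homeoD(1,6)[OF h] by (intro continuous_on_open_UN) auto
qed (use open_homeoD(1,2)[OF h] in auto)

lemma ex_open_homeo_UN:
  assumes h: "\<And>i. i \<in> I \<Longrightarrow> open_homeo (S i) (T i) (h i)"
    and S: "disjoint_family_on S I" and T: "disjoint_family_on T I"
  obtains F where "open_homeo (\<Union>i\<in>I. S i) (\<Union>i\<in>I. T i) F"
    "\<And>i x. i \<in> I \<Longrightarrow> x \<in> S i \<Longrightarrow> F x = h i x"
proof -
  define F where "F x = h (THE i. i \<in> I \<and> x \<in> S i) x" for x
  have F: "F x = h i x" if "i \<in> I" "x \<in> S i" for i x
  proof -
    have "(THE i. i \<in> I \<and> x \<in> S i) = i"
      using that S unfolding disjoint_family_on_def by (intro the_equality) blast+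
    then show ?thesis by (simp add: F_def)
  qed
  then show ?thesis by (intro that open_homeo_UN open_homeo_cong[OF h] T)
qed

lemma open_homeo_Un:
  assumes h: "open_homeo S T h" and h': "open_homeo S' T' h'"
    and "S \<inter> S' = {}" "T \<inter> T' = {}"
  shows "open_homeo (S \<union> S') (T \<union> T') (\<lambda>x. if x \<in> S then h x else h' x)" (is "open_homeo _ _ ?F")
proof -
  have "open_homeo (\<Union>b. if b then S else S') (\<Union>b. if b then T else T') ?F"
  proof (rule open_homeo_UN)
    show "open_homeo (if b then S else S') (if b then T else T') ?F" for b
      using assms(3) by (cases b) (auto intro!: open_homeo_cong[OF h] open_homeo_cong[OF h'])
    show "disjoint_family (\<lambda>b. if b then T else T')"
      using assms(4) by (auto simp: disjoint_family_on_def)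
  qed
  then show ?thesis by (simp add: UNIV_bool Un_commute)
qed

lemma closed_imp_compact:
  fixes A :: "'a::topological_space set"
  shows "compact (UNIV :: 'a set) \<Longrightarrow> closed A \<Longrightarrow> compact A"
  using compact_Int_closed[of UNIV A] by simp

text \<open>A continuous extension at one point comes for free: neighbourhoods of \<open>h e\<close> have compact
  complements in \<open>T\<close>, and compact sets pull back to compact sets.\<close>
lemma open_homeo_insert:
  fixes S :: "'a::t2_space set" and T :: "'b::t2_space set"
  assumes h: "open_homeo S T h" and e: "e \<notin> S" "h e \<notin> T"
    and S: "compact (insert e S)" "open (insert e S)"
    and T: "compact (insert (h e) T)" "open (insert (h e) T)"
  shows "open_homeo (insert e S) (insert (h e) T) h"
proof -
  have "open (h -` B \<inter> insert e S)" if B: "open B" for B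
  proof (cases "h e \<in> B")
    case False
    then have "h -` B \<inter> insert e S = h -` B \<inter> S" by auto
    then show ?thesis
      using open_homeoD(1,6)[OF h] B by (simp add: continuous_on_open_vimage)
  next
    case True
    have "insert (h e) T - B = T - B" using True by auto
    then have "compact (T - B)" using compact_diff[OF T(1) B] by simp
    then have "compact (inv_into S h ` (T - B))"
      using h by (intro compact_continuous_image)
        (auto simp: open_homeo_iff_continuous_on intro: continuous_on_subset)
    moreover have "inv_into S h ` (T - B) = S - h -` B"
    proof -
      have "T - B = h ` (S - h -` B)" using open_homeoD(5)[OF h] by auto
      then show ?thesis using inv_into_image_cancel[OF open_homeoD(4)[OF h]] by simp
    qed
    moreover have "h -` B \<inter> insert e S = insert e S - (S - h -` B)" using e True by auto
    ultimately show ?thesis using S(2) by (metis compact_imp_closed open_Diff)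
  qed
  then have "continuous_on (insert e S) h" using S(2) by (simp add: continuous_on_open_vimage)
  moreover have "inj_on h (insert e S)" "h ` insert e S = insert (h e) T"
    using open_homeoD(4,5)[OF h] e by auto
  ultimately show ?thesis
    using homeomorphism_compact[OF S(1)] S(2) T(2) unfolding open_homeo_def by blast
qed

lemma ex_open_homeo_wreath:
  assumes c: "\<And>p. open_homeo V (W p) (c p)" and W: "disjoint_family W"
    and r: "bij r" and h: "\<And>p. open_homeo V V (h p)"
  obtains F where "open_homeo (\<Union>p. W p) (\<Union>p. W p) F"
    "\<And>p x. x \<in> V \<Longrightarrow> F (c p x) = c (r p) (h p x)"
proof -
  have "open_homeo (W p) (W (r p)) (c (r p) \<circ> h p \<circ> inv_into V (c p))" for p
    using open_homeo_comp[OF open_homeo_inv_into[OF c] open_homeo_comp[OF h c]]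
    by (simp add: comp_assoc)
  moreover have "disjoint_family (\<lambda>p. W (r p))"
    using W r by (auto simp: disjoint_family_on_def bij_def inj_eq)
  ultimately obtain F where F: "open_homeo (\<Union>p. W p) (\<Union>p. W (r p)) F"
      "\<And>p y. y \<in> W p \<Longrightarrow> F y = c (r p) (h p (inv_into V (c p) y))"
    by (rule ex_open_homeo_UN[OF _ W]) auto
  have "(\<Union>p. W (r p)) = (\<Union>p. W p)" using r by (metis bij_is_surj image_image)
  moreover have "F (c p x) = c (r p) (h p x)" if "x \<in> V" for p x
    using F(2)[of "c p x" p] open_homeoD(4,7)[OF c] that by simp
  ultimately show ?thesis using F(1) that by simp
qed

definition homeo_invariant :: "'a::topological_space set \<Rightarrow> bool" where
  "homeo_invariant C \<longleftrightarrow> (\<forall>S T h. open_homeo S T h \<longrightarrow> h ` (S \<inter> C) \<subseteq> C)"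

lemma homeo_invariant_iff:
  assumes C: "homeo_invariant C" and h: "open_homeo S T h" and x: "x \<in> S"
  shows "h x \<in> C \<longleftrightarrow> x \<in> C"
proof
  assume "x \<in> C"
  then show "h x \<in> C" using C h x unfolding homeo_invariant_def by blast
next
  assume "h x \<in> C"
  then have "inv_into S h (h x) \<in> C"
    using C open_homeo_inv_into[OF h] open_homeoD(7)[OF h x] unfolding homeo_invariant_def by blast
  then show "x \<in> C" using open_homeoD(4)[OF h] x by simp
qed

lemma homeo_invariant_INT:
  "(\<And>i. i \<in> I \<Longrightarrow> homeo_invariant (A i)) \<Longrightarrow> homeo_invariant (\<Inter>i\<in>I. A i)"
  by (simp add: homeo_invariant_def image_subset_iff)

lemma homeo_invariant_limit_points:
  assumes C: "homeo_invariant C"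
  shows "homeo_invariant {x. x islimpt C}"
  unfolding homeo_invariant_def
proof (intro allI impI image_subsetI CollectI islimptI)
  fix S T :: "'a set" and h x U
  assume h: "open_homeo S T h" and x: "x \<in> S \<inter> {x. x islimpt C}" and U: "h x \<in> U" "open U"
  have "open (h -` U \<inter> S)"
    using U open_homeoD(1,6)[OF h] by (simp add: continuous_on_open_vimage)
  then obtain y where y: "y \<in> C" "y \<in> h -` U \<inter> S" "y \<noteq> x"
    using x U(1) by (metis IntD1 IntD2 IntI islimptE mem_Collect_eq vimageI)
  then have "h y \<in> C" "h y \<noteq> h x"
    using homeo_invariant_iff[OF C h] open_homeoD(4)[OF h] x by (auto simp: inj_on_eq_iff)
  then show "\<exists>y\<in>C. y \<in> U \<and> y \<noteq> h x" using y by blast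
qed

lemma homeo_invariant_cb_deriv:
  assumes f: "cb_deriv_seq f"
  shows "homeo_invariant (f i)"
proof (induction i rule: less_induct)
  case (less i)
  show ?case
  proof (cases "\<exists>j. wo_succ j i")
    case True
    then obtain j where "wo_succ j i" by blast
    then have "f i = {x. x islimpt f j}" "j < i"
      using f unfolding cb_deriv_seq_def wo_succ_def by blast+
    then show ?thesis using homeo_invariant_limit_points[OF less.IH] by simp
  next
    case False
    then have "f i = (\<Inter>j\<in>{j. j < i}. f j)"
      using f unfolding cb_deriv_seq_def by blast
    then show ?thesis using homeo_invariant_INT[of "{j. j < i}" f] less.IH by simp
  qed
qed

section \<open>Strongly bounded subsets of groups\<close>

context group
begin

lemma left_invariant_norm_mult:
  assumes "left_invariant_metric G d" "x \<in> carrier G" "y \<in> carrier G"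
  shows "d \<one> (x \<otimes> y) \<le> d \<one> x + d \<one> y"
proof -
  have "d (x \<otimes> \<one>) (x \<otimes> y) = d \<one> y"
    using assms one_closed unfolding left_invariant_metric_def by blast
  moreover have "d \<one> (x \<otimes> y) \<le> d \<one> x + d x (x \<otimes> y)"
    using assms one_closed m_closed unfolding left_invariant_metric_def by blast
  ultimately show ?thesis using assms(2) by simp
qed

lemma left_invariant_norm_inv:
  assumes "left_invariant_metric G d" "x \<in> carrier G"
  shows "d \<one> (inv x) = d \<one> x"
proof -
  have "d (x \<otimes> \<one>) (x \<otimes> inv x) = d \<one> (inv x)"
    using assms one_closed inv_closed unfolding left_invariant_metric_def by blast
  moreover have "d x \<one> = d \<one> x"
    using assms one_closed unfolding left_invariant_metric_def by blast
  ultimately show ?thesis using assms(2) by simp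
qed

lemma left_invariant_norm_pow:
  assumes d: "left_invariant_metric G d" and x: "x \<in> carrier G"
  shows "d \<one> (x [^] n) \<le> real n * d \<one> x"
proof (induction n)
  case 0
  have "d \<one> \<one> = 0" using d one_closed unfolding left_invariant_metric_def by blast
  then show ?case by simp
next
  case (Suc n)
  then show ?case
    using left_invariant_norm_mult[OF d nat_pow_closed[OF x] x, of n] by (simp add: algebra_simps)
qed

lemma strongly_bounded_iff_bdd_above:
  "strongly_bounded G A \<longleftrightarrow>
     A \<subseteq> carrier G \<and> (\<forall>d. left_invariant_metric G d \<longrightarrow> bdd_above (d \<one> ` A))"
proof -
  have "(\<exists>M. \<forall>x\<in>A. \<forall>y\<in>A. d x y \<le> M) \<longleftrightarrow> bdd_above (d \<one> ` A)"
    if d: "left_invariant_metric G d" and A: "A \<subseteq> carrier G" for d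
  proof
    assume "\<exists>M. \<forall>x\<in>A. \<forall>y\<in>A. d x y \<le> M"
    then obtain M where M: "\<And>x y. x \<in> A \<Longrightarrow> y \<in> A \<Longrightarrow> d x y \<le> M" by blast
    have "d \<one> y \<le> d \<one> x + M" if "x \<in> A" "y \<in> A" for x y
      using M[OF that] d that A one_closed unfolding left_invariant_metric_def
      by (smt (verit, ccfv_threshold) subsetD)
    then show "bdd_above (d \<one> ` A)" unfolding bdd_above_def by blast
  next
    assume "bdd_above (d \<one> ` A)"
    then obtain M where M: "\<And>x. x \<in> A \<Longrightarrow> d \<one> x \<le> M" by (auto simp: bdd_above_def)
    have "d x y \<le> M + M" if "x \<in> A" "y \<in> A" for x y
      using M[OF that(1)] M[OF that(2)] d that A one_closed unfolding left_invariant_metric_def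
      by (smt (verit, ccfv_threshold) subsetD)
    then show "\<exists>M. \<forall>x\<in>A. \<forall>y\<in>A. d x y \<le> M" by blast
  qed
  then show ?thesis unfolding strongly_bounded_def by (intro conj_cong refl all_cong) auto
qed

lemma strongly_bounded_subset: "strongly_bounded G B \<Longrightarrow> A \<subseteq> B \<Longrightarrow> strongly_bounded G A"
  unfolding strongly_bounded_iff_bdd_above by (meson bdd_above_mono image_mono subset_trans)

lemma strongly_bounded_finite: "finite A \<Longrightarrow> A \<subseteq> carrier G \<Longrightarrow> strongly_bounded G A"
  unfolding strongly_bounded_iff_bdd_above by simp

lemma strongly_bounded_Un:
  "strongly_bounded G A \<Longrightarrow> strongly_bounded G B \<Longrightarrow> strongly_bounded G (A \<union> B)"
  unfolding strongly_bounded_iff_bdd_above by (simp add: image_Un)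

lemma strongly_bounded_UN:
  "finite I \<Longrightarrow> (\<And>i. i \<in> I \<Longrightarrow> strongly_bounded G (A i)) \<Longrightarrow> strongly_bounded G (\<Union>i\<in>I. A i)"
  unfolding strongly_bounded_iff_bdd_above by (auto simp: image_UN)

lemma strongly_bounded_set_mult:
  assumes "strongly_bounded G A" "strongly_bounded G B"
  shows "strongly_bounded G (A <#> B)"
  unfolding strongly_bounded_iff_bdd_above
proof (intro conjI allI impI)
  have AB: "A \<subseteq> carrier G" "B \<subseteq> carrier G"
    using assms unfolding strongly_bounded_def by blast+
  then show "A <#> B \<subseteq> carrier G" by (rule set_mult_closed)
  fix d assume d: "left_invariant_metric G d"
  then have "bdd_above (d \<one> ` A)" "bdd_above (d \<one> ` B)"
    using assms unfolding strongly_bounded_iff_bdd_above by simp_all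
  then obtain M N where M: "\<And>x. x \<in> A \<Longrightarrow> d \<one> x \<le> M" and N: "\<And>y. y \<in> B \<Longrightarrow> d \<one> y \<le> N"
    by (auto simp: bdd_above_def)
  have "d \<one> (x \<otimes> y) \<le> M + N" if "x \<in> A" "y \<in> B" for x y
    using left_invariant_norm_mult[OF d, of x y] M[OF that(1)] N[OF that(2)] AB that by fastforce
  then show "bdd_above (d \<one> ` (A <#> B))" unfolding bdd_above_def set_mult_def by auto
qed

lemma strongly_boundedI_linear_growth:
  assumes A: "A \<subseteq> carrier G"
    and growth: "\<And>d a. left_invariant_metric G d \<Longrightarrow> range a \<subseteq> A \<Longrightarrow>
      \<exists>\<alpha> \<beta>. \<forall>k::nat. d \<one> (a k) \<le> \<alpha> * real k + \<beta>"
  shows "strongly_bounded G A"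
  unfolding strongly_bounded_iff_bdd_above
proof (intro conjI allI impI A)
  fix d assume d: "left_invariant_metric G d"
  show "bdd_above (d \<one> ` A)"
  proof (rule ccontr)
    assume "\<not> bdd_above (d \<one> ` A)"
    then have "\<exists>x\<in>A. real k * real k < d \<one> x" for k :: nat
      by (auto simp: bdd_above_def not_le)
    then obtain a where a: "\<And>k. a k \<in> A" "\<And>k::nat. real k * real k < d \<one> (a k)" by metis
    obtain \<alpha> \<beta> where growth_a: "\<And>k::nat. d \<one> (a k) \<le> \<alpha> * real k + \<beta>"
      using growth[OF d, of a] a(1) by blast
    have "\<forall>\<^sub>F k in sequentially. \<alpha> * real k + \<beta> < real k * real k" by real_asymp
    then obtain k :: nat where "\<alpha> * real k + \<beta> < real k * real k"
      using eventually_happens'[OF sequentially_bot] by blast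
    then show False using a(2)[of k] growth_a[of k] by linarith
  qed
qed

lemma strongly_boundedI_commutators:
  assumes A: "A \<subseteq> carrier G"
    and comm: "\<And>a. range a \<subseteq> A \<Longrightarrow> \<exists>g\<in>carrier G. \<exists>s\<in>carrier G. \<exists>t\<in>carrier G. \<forall>k::nat.
      a k \<otimes> (t \<otimes> (inv (s [^] k) \<otimes> g \<otimes> s [^] k)) = inv (s [^] k) \<otimes> g \<otimes> s [^] k \<otimes> t"
  shows "strongly_bounded G A"
proof (rule strongly_boundedI_linear_growth[OF A])
  fix d and a :: "nat \<Rightarrow> 'a"
  assume d: "left_invariant_metric G d" and a: "range a \<subseteq> A"
  obtain g s t where mem: "g \<in> carrier G" "s \<in> carrier G" "t \<in> carrier G"
    and eq: "\<And>k. a k \<otimes> (t \<otimes> (inv (s [^] k) \<otimes> g \<otimes> s [^] k)) = inv (s [^] k) \<otimes> g \<otimes> s [^] k \<otimes> t"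
    using comm[OF a] by blast
  note norm_mult = left_invariant_norm_mult[OF d] and norm_inv = left_invariant_norm_inv[OF d]
  have "d \<one> (a k) \<le> (4 * d \<one> s) * real k + (2 * d \<one> g + 2 * d \<one> t)" for k
  proof -
    define w where "w = inv (s [^] k) \<otimes> g \<otimes> s [^] k"
    have w: "w \<in> carrier G" using mem by (simp add: w_def)
    have "a k \<in> carrier G" using a A by blast
    then have "a k = (w \<otimes> t) \<otimes> inv (t \<otimes> w)"
      using eq[of k, folded w_def] w mem by (subst inv_solve_right) simp_all
    then have "d \<one> (a k) \<le> 2 * (d \<one> w + d \<one> t)"
      using norm_mult[of "w \<otimes> t" "inv (t \<otimes> w)"] norm_mult[of w t] norm_mult[of t w]
        norm_inv[of "t \<otimes> w"] w mem by simp
    moreover have "d \<one> w \<le> d \<one> g + 2 * d \<one> (s [^] k)"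
      using norm_mult[of "inv (s [^] k) \<otimes> g" "s [^] k"] norm_mult[of "inv (s [^] k)" g]
        norm_inv[of "s [^] k"] mem by (simp add: w_def)
    moreover have "d \<one> (s [^] k) \<le> real k * d \<one> s"
      using left_invariant_norm_pow[OF d mem(2)] .
    ultimately show ?thesis by (simp add: algebra_simps)
  qed
  then show "\<exists>\<alpha> \<beta>. \<forall>k::nat. d \<one> (a k) \<le> \<alpha> * real k + \<beta>" by blast
qed

end

section \<open>The homeomorphism group\<close>

lemma carrier_Homeo: "h \<in> carrier Homeo \<longleftrightarrow> open_homeo UNIV UNIV h"
  by (simp add: Homeo_def open_homeo_def)

lemma mult_Homeo: "g \<otimes>\<^bsub>Homeo\<^esub> h = g \<circ> h"
  by (simp add: Homeo_def)

lemma one_Homeo: "\<one>\<^bsub>Homeo\<^esub> = id"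
  by (simp add: Homeo_def)

lemma group_Homeo: "group (Homeo :: ('a::topological_space \<Rightarrow> 'a) monoid)"
proof (rule groupI)
  fix h :: "'a \<Rightarrow> 'a"
  assume h: "h \<in> carrier Homeo"
  then have "inv_into UNIV h \<circ> h = id"
    using open_homeoD(4)[of UNIV UNIV h] by (simp add: carrier_Homeo)
  then show "\<exists>g\<in>carrier Homeo. g \<otimes>\<^bsub>Homeo\<^esub> h = \<one>\<^bsub>Homeo\<^esub>"
    using h open_homeo_inv_into[of UNIV UNIV h] by (auto simp: carrier_Homeo mult_Homeo one_Homeo)
qed (auto simp: carrier_Homeo mult_Homeo one_Homeo comp_assoc open_homeo_id intro: open_homeo_comp)

interpretation Homeo: group "Homeo :: ('a::topological_space \<Rightarrow> 'a) monoid"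
  rewrites "mult (Homeo :: ('a \<Rightarrow> 'a) monoid) = (\<circ>)" and "one (Homeo :: ('a \<Rightarrow> 'a) monoid) = id"
  using group_Homeo by (auto simp: fun_eq_iff mult_Homeo one_Homeo)

lemma pow_Homeo: "h [^]\<^bsub>Homeo\<^esub> (n::nat) = h ^^ n"
  by (induction n) (auto simp: mult_Homeo one_Homeo funpow_swap1 fun_eq_iff)

lemma subgroup_Homeo_comp: "subgroup H Homeo \<Longrightarrow> g \<in> H \<Longrightarrow> h \<in> H \<Longrightarrow> g \<circ> h \<in> H"
  using subgroup.m_closed[of H Homeo g h] by (simp add: mult_Homeo)

lemma subgroup_Homeo_funpow: "subgroup H Homeo \<Longrightarrow> h \<in> H \<Longrightarrow> h ^^ n \<in> H"
  using subgroup.one_closed[of H Homeo]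
  by (induction n) (auto simp: one_Homeo id_def[symmetric] intro: subgroup_Homeo_comp)

lemma Homeo_funpow: "h \<in> carrier Homeo \<Longrightarrow> h ^^ n \<in> carrier Homeo"
  using Homeo.nat_pow_closed[of h n] by (simp add: pow_Homeo)

lemma Homeo_inv_apply:
  assumes "h \<in> carrier Homeo"
  shows "h ((inv\<^bsub>Homeo\<^esub> h) x) = x" "(inv\<^bsub>Homeo\<^esub> h) (h x) = x"
  using Homeo.r_inv[OF assms] Homeo.l_inv[OF assms] by (metis comp_apply id_apply)+

lemma Homeo_bij: "h \<in> carrier Homeo \<Longrightarrow> bij h"
  by (auto simp: carrier_Homeo dest: open_homeoD(3))

lemma Homeo_inj: "h \<in> carrier Homeo \<Longrightarrow> inj h"
  by (simp add: Homeo_bij bij_is_inj)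

lemma Homeo_open_homeo: "h \<in> carrier Homeo \<Longrightarrow> open U \<Longrightarrow> open_homeo U (h ` U) h"
  using open_homeo_subset[of UNIV UNIV h U] by (simp add: carrier_Homeo)

lemma Homeo_open_image: "h \<in> carrier Homeo \<Longrightarrow> open U \<Longrightarrow> open (h ` U)"
  using Homeo_open_homeo open_homeoD(2) by blast

lemma Homeo_closed_image:
  "h \<in> carrier Homeo \<Longrightarrow> closed U \<Longrightarrow> closed (h ` U)"
  using Homeo_open_image[of h "- U"] Homeo_bij[of h] by (simp add: closed_def bij_image_Compl_eq)

lemma Homeo_open_vimage: "h \<in> carrier Homeo \<Longrightarrow> open U \<Longrightarrow> open (h -` U)"
  by (auto simp: carrier_Homeo dest: open_homeoD(6) intro: open_vimage)

definition supported :: "'a::topological_space set \<Rightarrow> ('a \<Rightarrow> 'a) set" where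
  "supported S = {h \<in> carrier Homeo. \<forall>x. x \<notin> S \<longrightarrow> h x = x}"

lemma supported_mono: "S \<subseteq> T \<Longrightarrow> supported S \<subseteq> supported T"
  by (auto simp: supported_def)

lemma subgroup_supported: "subgroup (supported S) Homeo"
proof (rule Homeo.subgroupI)
  fix g assume g: "g \<in> supported S"
  then have "(inv\<^bsub>Homeo\<^esub> g) x = x" if "x \<notin> S" for x
    using that Homeo_inv_apply(2)[of g x] by (simp add: supported_def)
  then show "inv\<^bsub>Homeo\<^esub> g \<in> supported S" using g by (simp add: supported_def)
qed (auto simp: supported_def mult_Homeo)

lemmas supported_comp = subgroup_Homeo_comp[OF subgroup_supported]
  and supported_inv = subgroup.m_inv_closed[OF subgroup_supported]
  and supported_funpow = subgroup_Homeo_funpow[OF subgroup_supported]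



lemma supportedD:
  assumes "h \<in> supported S"
  shows "h \<in> carrier Homeo" "\<And>x. x \<notin> S \<Longrightarrow> h x = x" "\<And>x. h x \<in> S \<longleftrightarrow> x \<in> S" "h ` S = S"
proof -
  show h: "h \<in> carrier Homeo" and fixed: "\<And>x. x \<notin> S \<Longrightarrow> h x = x"
    using assms by (auto simp: supported_def)
  show mem: "h x \<in> S \<longleftrightarrow> x \<in> S" for x
    using fixed[of x] fixed[of "h x"] Homeo_inj[OF h] by (metis injD)
  show "h ` S = S"
    using mem Homeo_inv_apply(1)[OF h] by (metis image_eqI image_subsetI subsetI subset_antisym)
qed

lemma supported_open_homeo: "h \<in> supported S \<Longrightarrow> open S \<Longrightarrow> open_homeo S S h"
  using Homeo_open_homeo[of h S] supportedD(1,4)[of h S] by simp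

lemma extend_by_id_supported:
  assumes h: "open_homeo S S h" and S: "closed S"
  shows "(\<lambda>x. if x \<in> S then h x else x) \<in> supported S"
proof -
  have "open_homeo (S \<union> - S) (S \<union> - S) (\<lambda>x. if x \<in> S then h x else id x)"
    by (rule open_homeo_Un[OF h open_homeo_id]) (use S in auto)
  then show ?thesis unfolding id_apply by (simp add: supported_def carrier_Homeo)
qed

lemma ex_supported_comp_eq:
  assumes S: "open S" "closed S" and a: "a \<in> carrier Homeo" "a ` S \<subseteq> S"
    and b: "b \<in> carrier Homeo" "b ` S \<subseteq> S" and v: "open_homeo (S - a ` S) (S - b ` S) v"
  obtains u where "u \<in> supported S" "\<And>x. x \<in> S \<Longrightarrow> u (a x) = b x"
proof -
  define u where "u x = (if x \<in> a ` S then (b \<circ> inv\<^bsub>Homeo\<^esub> a) x else v x)" for x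
  have "(b \<circ> inv\<^bsub>Homeo\<^esub> a) ` a ` S = b ` S" by (simp add: image_image Homeo_inv_apply(2)[OF a(1)])
  moreover have "b \<circ> inv\<^bsub>Homeo\<^esub> a \<in> carrier Homeo" using a(1) b(1) by simp
  ultimately have "open_homeo (a ` S) (b ` S) (b \<circ> inv\<^bsub>Homeo\<^esub> a)"
    using Homeo_open_homeo Homeo_open_image[OF a(1) S(1)] by metis
  then have "open_homeo (a ` S \<union> (S - a ` S)) (b ` S \<union> (S - b ` S)) u"
    unfolding u_def by (rule open_homeo_Un[OF _ v]) auto
  moreover have "a ` S \<union> (S - a ` S) = S" "b ` S \<union> (S - b ` S) = S" using a(2) b(2) by auto
  ultimately have "open_homeo S S u" by simp
  then have "(\<lambda>x. if x \<in> S then u x else x) \<in> supported S"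
    using S(2) by (rule extend_by_id_supported)
  moreover have "(if a x \<in> S then u (a x) else a x) = b x" if "x \<in> S" for x
  proof -
    have "a x \<in> a ` S" "a x \<in> S" using that a(2) by auto
    then show ?thesis by (simp add: u_def Homeo_inv_apply(2)[OF a(1)])
  qed
  ultimately show thesis by (rule that)
qed

section \<open>Clopen subsets of compact well-ordered spaces\<close>

abbreviation clopen :: "'a::topological_space set \<Rightarrow> bool" where
  "clopen S \<equiv> open S \<and> closed S"

lemma clopen_atMost: "clopen {..x :: 'a::{wellorder, linorder_topology}}"
proof (cases "\<exists>y. x < y")
  case True
  define y where "y = (LEAST y. x < y)"
  have "{..x} = {..<y}"
    using LeastI_ex[OF True] not_less_Least[of _ "\<lambda>y. x < y"] unfolding y_def
    by (auto simp: not_less[symmetric])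
  then show ?thesis by (metis closed_atMost open_lessThan)
next
  case False
  then have "{..x} = UNIV" by (auto simp: not_less)
  then show ?thesis by simp
qed

lemma clopen_Int_atMost:
  fixes Z :: "'a::{wellorder, linorder_topology} set"
  shows "clopen Z \<Longrightarrow> clopen (Z \<inter> {..z})"
  using clopen_atMost by auto

lemma clopen_Diff_atMost:
  fixes Z :: "'a::{wellorder, linorder_topology} set"
  shows "clopen Z \<Longrightarrow> clopen (Z - {..z})"
  using clopen_atMost by auto

definition initial_embedding :: "'a::wellorder set \<Rightarrow> 'b::wellorder set \<Rightarrow> ('a \<Rightarrow> 'b) \<Rightarrow> bool" where
  "initial_embedding A B f \<longleftrightarrow>
     strict_mono_on A f \<and> f ` A \<subseteq> B \<and> (\<forall>x\<in>A. \<forall>y\<in>B. y \<le> f x \<longrightarrow> y \<in> f ` A)"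

definition le_on :: "'a::wellorder set \<Rightarrow> 'a rel" where
  "le_on A = {(x, y). x \<in> A \<and> y \<in> A \<and> x \<le> y}"

lemma Field_le_on: "Field (le_on A) = A"
  by (auto simp: le_on_def Field_def)

lemma Well_order_le_on: "Well_order (le_on A)"
proof -
  have "wf (le_on A - Id)"
    by (rule wf_subset[OF wellorder_class.wf]) (auto simp: le_on_def)
  then show ?thesis
    unfolding well_order_on_def linear_order_on_def partial_order_on_def preorder_on_def Field_le_on
    by (auto simp: le_on_def refl_on_def trans_def antisym_def total_on_def)
qed

lemma embed_le_on_imp_initial_embedding:
  assumes "embed (le_on A) (le_on B) f"
  shows "initial_embedding A B f"
proof -
  have im: "f ` A \<subseteq> B" using embed_Field[OF assms] by (simp add: Field_le_on)
  have "f x < f y" if "x \<in> A" "y \<in> A" "x < y" for x y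
  proof -
    have "f x \<le> f y" using embed_compat[OF assms] that by (auto simp: compat_def le_on_def)
    moreover have "f x \<noteq> f y"
      using embed_inj_on[OF Well_order_le_on assms] that by (auto simp: Field_le_on inj_on_def)
    ultimately show ?thesis by simp
  qed
  moreover have "y \<in> f ` A" if "x \<in> A" "y \<in> B" "y \<le> f x" for x y
  proof -
    have "bij_betw f (under (le_on A) x) (under (le_on B) (f x))"
      using assms that(1) by (simp add: embed_def Field_le_on)
    moreover have "y \<in> under (le_on B) (f x)" using that im by (auto simp: under_def le_on_def)
    ultimately show ?thesis by (auto simp: bij_betw_def under_def le_on_def)
  qed
  ultimately show ?thesis using im by (simp add: initial_embedding_def strict_mono_on_def)
qed

lemma ex_initial_embedding:
  obtains f where "initial_embedding A B f" | g where "initial_embedding B A g"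
  using wellorders_totally_ordered[OF Well_order_le_on[of A] Well_order_le_on[of B]]
    embed_le_on_imp_initial_embedding by metis

lemma strict_mono_on_open_vimage_lessThan:
  fixes f :: "'a::{wellorder, linorder_topology} \<Rightarrow> 'b::linorder"
  assumes f: "strict_mono_on A f"
  shows "\<exists>U. open U \<and> U \<inter> A = f -` {..<b} \<inter> A"
proof (cases "\<exists>u. u \<in> A \<and> b \<le> f u")
  case True
  define u where "u = (LEAST u. u \<in> A \<and> b \<le> f u)"
  have u: "u \<in> A" "b \<le> f u" using LeastI_ex[OF True] by (simp_all add: u_def)
  have "x < u \<longleftrightarrow> f x < b" if "x \<in> A" for x
    using that u strict_mono_on_less[OF f that u(1)] not_less_Least[of x "\<lambda>u. u \<in> A \<and> b \<le> f u"]
    by (auto simp: u_def[symmetric] not_le)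
  then show ?thesis by (intro exI[of _ "{..<u}"]) auto
next
  case False
  then show ?thesis by (intro exI[of _ UNIV]) (auto simp: not_le)
qed

lemma strict_mono_on_open_vimage_greaterThan:
  fixes f :: "'a::linorder_topology \<Rightarrow> 'b::linorder_topology"
  assumes f: "strict_mono_on A f" and compact: "compact (f ` A)"
  shows "\<exists>U. open U \<and> U \<inter> A = f -` {a<..} \<inter> A"
proof (cases "f ` A \<inter> {..a} = {}")
  case True
  then show ?thesis by (intro exI[of _ UNIV]) (auto simp: not_le[symmetric])
next
  case False
  moreover have "compact (f ` A \<inter> {..a})" using compact by auto
  ultimately obtain u where u: "u \<in> A" "f u \<le> a" "\<And>x. x \<in> A \<Longrightarrow> f x \<le> a \<Longrightarrow> f x \<le> f u"
    using compact_attains_sup[of "f ` A \<inter> {..a}"] by auto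
  have "u < x \<longleftrightarrow> a < f x" if "x \<in> A" for x
    using u(2) u(3)[OF that] strict_mono_on_less[OF f u(1) that] by (meson leD leI le_less_trans)
  then show ?thesis by (intro exI[of _ "{u<..}"]) auto
qed

lemma strict_mono_on_compact_image_imp_continuous_on:
  fixes f :: "'a::{wellorder, linorder_topology} \<Rightarrow> 'b::linorder_topology"
  assumes "strict_mono_on A f" "compact (f ` A)"
  shows "continuous_on A f"
  using strict_mono_on_open_vimage_lessThan[OF assms(1)]
    strict_mono_on_open_vimage_greaterThan[OF assms]
  by (intro continuous_on_generate_topology[OF open_generated_order]) auto

lemma initial_embedding_open_homeo:
  fixes A B :: "'a::{wellorder, linorder_topology} set"
  assumes compact: "compact (UNIV :: 'a set)" and f: "initial_embedding A B f"
    and A: "clopen A" and B: "clopen B" and a: "a \<in> A" "\<forall>x\<in>A. x \<le> a"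
  shows "open_homeo A (B \<inter> {..f a}) f"
proof -
  have mono: "strict_mono_on A f" using f by (simp add: initial_embedding_def)
  have im: "f ` A = B \<inter> {..f a}"
    using f a strict_mono_on_leD[OF mono] by (auto simp: initial_embedding_def)
  have "continuous_on A f"
    using mono clopen_Int_atMost[OF B, of "f a"] im
    by (intro strict_mono_on_compact_image_imp_continuous_on closed_imp_compact[OF compact]) auto
  then obtain g where "homeomorphism A (B \<inter> {..f a}) f g"
    using homeomorphism_compact closed_imp_compact[OF compact] A im
      strict_mono_on_imp_inj_on[OF mono] by metis
  then show ?thesis using A clopen_Int_atMost[OF B] unfolding open_homeo_def by blast
qed

context
  fixes C :: "'a::{wellorder, linorder_topology} set"
  assumes compact_UNIV: "compact (UNIV :: 'a set)" and C_invariant: "homeo_invariant C"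
begin

lemma initial_embedding_Max_open_homeo:
  assumes f: "initial_embedding A B f"
    and A: "clopen A" "A \<inter> C = {a}" "\<forall>x\<in>A. x \<le> a" and B: "clopen B" "B \<inter> C = {b}" "\<forall>x\<in>B. x \<le> b"
  shows "open_homeo A B f"
proof -
  have a: "a \<in> A" "a \<in> C" using A(2) by auto
  have h: "open_homeo A (B \<inter> {..f a}) f"
    using initial_embedding_open_homeo[OF compact_UNIV f A(1) B(1) a(1) A(3)] .
  have "f a \<in> B \<inter> C" using homeo_invariant_iff[OF C_invariant h] open_homeoD(7)[OF h] a by simp
  then have "B \<inter> {..f a} = B" using B(2,3) by auto
  then show ?thesis using h by simp
qed

lemma ex_open_homeo_Max:
  assumes "clopen Z" "Z \<inter> C = {z}" "\<forall>x\<in>Z. x \<le> z" "clopen Z'" "Z' \<inter> C = {z'}" "\<forall>x\<in>Z'. x \<le> z'"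
  shows "\<exists>h. open_homeo Z Z' h"
proof (rule ex_initial_embedding[of Z Z'])
  show ?thesis if "initial_embedding Z Z' f" for f
    using initial_embedding_Max_open_homeo[OF that assms] by blast
  show ?thesis if "initial_embedding Z' Z g" for g
    using open_homeo_inv_into[OF initial_embedding_Max_open_homeo[OF that assms(4-6,1-3)]] by blast
qed

lemma ex_open_homeo_initial_part:
  assumes Z: "clopen Z" "Z \<inter> C = {z}" "\<forall>x\<in>Z. x \<le> z" and W: "clopen W" "W \<inter> C = {}" "W \<noteq> {}"
  obtains w h where "w < z" "open_homeo W (Z \<inter> {..w}) h"
proof (rule ex_initial_embedding[of W Z])
  fix f assume f: "initial_embedding W Z f"
  obtain m where m: "m \<in> W" "\<forall>x\<in>W. x \<le> m"
    using compact_attains_sup[of W] closed_imp_compact[OF compact_UNIV] W by metis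
  have h: "open_homeo W (Z \<inter> {..f m}) f"
    using initial_embedding_open_homeo[OF compact_UNIV f W(1) Z(1) m] .
  have "f m \<notin> C" using homeo_invariant_iff[OF C_invariant h m(1)] W(2) m(1) by auto
  moreover have "z \<in> C" using Z(2) by auto
  moreover have "f m \<in> Z" using open_homeoD(7)[OF h m(1)] by simp
  ultimately have "f m < z" using Z(3) by (metis order_le_less)
  then show thesis using that h by blast
next
  fix f assume f: "initial_embedding Z W f"
  have z: "z \<in> Z" "z \<in> C" using Z(2) by auto
  have h: "open_homeo Z (W \<inter> {..f z}) f"
    using initial_embedding_open_homeo[OF compact_UNIV f Z(1) W(1) z(1) Z(3)] .
  have "f z \<in> W \<inter> C" using homeo_invariant_iff[OF C_invariant h] open_homeoD(7)[OF h] z by simp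
  then show thesis using W(2) by simp
qed

text \<open>As \<open>1 + \<alpha> = \<alpha>\<close> for infinite \<open>\<alpha>\<close>: a set missing \<open>C\<close> can be moved below the largest point.\<close>
lemma ex_open_homeo_absorb:
  assumes Z: "clopen Z" "Z \<inter> C = {z}" "\<forall>x\<in>Z. x \<le> z"
    and W: "clopen W" "W \<inter> C = {}" "Z \<inter> W = {}"
  shows "\<exists>h. open_homeo (Z \<union> W) Z h"
proof (cases "W = {}")
  case True
  then show ?thesis using Z open_homeo_id[of Z] by auto
next
  case False
  then obtain w h where w: "w < z" and h: "open_homeo W (Z \<inter> {..w}) h"
    using ex_open_homeo_initial_part[OF Z W(1,2)] by blast
  have "(Z - {..w}) \<inter> C = {z}" using Z(2) w by auto
  then obtain g where g: "open_homeo Z (Z - {..w}) g"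
    using ex_open_homeo_Max[OF Z clopen_Diff_atMost[OF Z(1)], of w z] Z(3) by auto
  have "open_homeo (Z \<union> W) ((Z - {..w}) \<union> (Z \<inter> {..w})) (\<lambda>x. if x \<in> Z then g x else h x)"
    by (rule open_homeo_Un[OF g h]) (use W(3) in auto)
  moreover have "(Z - {..w}) \<union> (Z \<inter> {..w}) = Z" by auto
  ultimately show ?thesis by auto
qed

lemma ex_open_homeo_Int_atMost:
  assumes Z: "clopen Z" "Z \<inter> C = {z}"
  shows "\<exists>h. open_homeo Z (Z \<inter> {..z}) h"
proof -
  note below = clopen_Int_atMost[OF Z(1), of z] and above = clopen_Diff_atMost[OF Z(1), of z]
  have "(Z - {..z}) \<inter> C = {}" "Z \<inter> {..z} \<inter> C = {z}" using Z(2) by (auto simp: set_eq_iff)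
  then have "\<exists>h. open_homeo (Z \<inter> {..z} \<union> (Z - {..z})) (Z \<inter> {..z}) h"
    by (intro ex_open_homeo_absorb[OF below _ _ above]) auto
  then show ?thesis by (simp add: Int_Diff_Un)
qed

lemma ex_open_homeo_singleton:
  assumes Z: "clopen Z" "Z \<inter> C = {z}" and Z': "clopen Z'" "Z' \<inter> C = {z'}"
  shows "\<exists>h. open_homeo Z Z' h"
proof -
  obtain g g' where g: "open_homeo Z (Z \<inter> {..z}) g" and g': "open_homeo Z' (Z' \<inter> {..z'}) g'"
    using ex_open_homeo_Int_atMost[OF Z] ex_open_homeo_Int_atMost[OF Z'] by blast
  obtain k where k: "open_homeo (Z \<inter> {..z}) (Z' \<inter> {..z'}) k"
    using Z(2) Z'(2)
      ex_open_homeo_Max[OF clopen_Int_atMost[OF Z(1)] _ _ clopen_Int_atMost[OF Z'(1)], of z z z' z']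
    by auto
  show ?thesis using open_homeo_comp[OF open_homeo_comp[OF g k] open_homeo_inv_into[OF g']] by blast
qed

lemma ex_split_off_first_point:
  assumes "finite (Z \<inter> C)" "Z \<inter> C \<noteq> {}"
  obtains z where "z \<in> Z \<inter> C" "(Z \<inter> {..z}) \<inter> C = {z}" "(Z - {..z}) \<inter> C = Z \<inter> C - {z}"
proof
  have "Min (Z \<inter> C) \<in> Z \<inter> C" "\<And>x. x \<in> Z \<inter> C \<Longrightarrow> Min (Z \<inter> C) \<le> x"
    using Min_in[OF assms] Min_le[OF assms(1)] by blast+
  then show "Min (Z \<inter> C) \<in> Z \<inter> C" "(Z \<inter> {..Min (Z \<inter> C)}) \<inter> C = {Min (Z \<inter> C)}"
    "(Z - {..Min (Z \<inter> C)}) \<inter> C = Z \<inter> C - {Min (Z \<inter> C)}"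
    by (auto intro: antisym)
qed

lemma ex_open_homeo_card:
  assumes "clopen Z" "clopen Z'" "card (Z \<inter> C) = Suc n" "card (Z' \<inter> C) = Suc n"
  shows "\<exists>h. open_homeo Z Z' h"
  using assms
proof (induction n arbitrary: Z Z')
  case 0
  then show ?case using ex_open_homeo_singleton by (metis One_nat_def card_1_singletonE)
next
  case (Suc n)
  note Z = Suc.prems(1) and Z' = Suc.prems(2)
  have fin: "finite (Z \<inter> C)" "Z \<inter> C \<noteq> {}" "finite (Z' \<inter> C)" "Z' \<inter> C \<noteq> {}"
    using Suc.prems by (auto intro: card_ge_0_finite)
  obtain z where z: "z \<in> Z \<inter> C" "(Z \<inter> {..z}) \<inter> C = {z}" "(Z - {..z}) \<inter> C = Z \<inter> C - {z}"
    using ex_split_off_first_point[OF fin(1,2)] by blast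
  obtain z' where z': "z' \<in> Z' \<inter> C" "(Z' \<inter> {..z'}) \<inter> C = {z'}" "(Z' - {..z'}) \<inter> C = Z' \<inter> C - {z'}"
    using ex_split_off_first_point[OF fin(3,4)] by blast
  obtain g where g: "open_homeo (Z \<inter> {..z}) (Z' \<inter> {..z'}) g"
    using ex_open_homeo_singleton[OF clopen_Int_atMost[OF Z] z(2) clopen_Int_atMost[OF Z'] z'(2)]
    by blast
  have "card ((Z - {..z}) \<inter> C) = Suc n" "card ((Z' - {..z'}) \<inter> C) = Suc n"
    unfolding z(3) z'(3) using Suc.prems z(1) z'(1) by simp_all
  then obtain h where h: "open_homeo (Z - {..z}) (Z' - {..z'}) h"
    using Suc.IH[OF clopen_Diff_atMost[OF Z] clopen_Diff_atMost[OF Z']] by blast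
  have "open_homeo (Z \<inter> {..z} \<union> (Z - {..z})) (Z' \<inter> {..z'} \<union> (Z' - {..z'}))
      (\<lambda>x. if x \<in> Z \<inter> {..z} then g x else h x)"
    by (rule open_homeo_Un[OF g h]) auto
  then show ?case by (auto simp: Int_Diff_Un)
qed

end

section \<open>Decomposition into pieces with a single point of \<open>C\<close>\<close>

definition ceil_in :: "'a::wellorder set \<Rightarrow> 'a \<Rightarrow> 'a \<Rightarrow> 'a" where
  "ceil_in M m d = (if \<exists>x\<in>M. d \<le> x then LEAST x. x \<in> M \<and> d \<le> x else m)"

lemma ceil_in_bounds:
  assumes "x \<in> M" "d \<le> x"
  shows "ceil_in M m d \<in> M" "d \<le> ceil_in M m d" "ceil_in M m d \<le> x"
  using assms LeastI[of "\<lambda>x. x \<in> M \<and> d \<le> x" x] Least_le[of "\<lambda>x. x \<in> M \<and> d \<le> x" x]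
  unfolding ceil_in_def by auto

lemma ceil_in_mem: "m \<in> M \<Longrightarrow> ceil_in M m d \<in> M"
  using ceil_in_bounds(1)[of _ M d m] by (metis ceil_in_def)

lemma ceil_in_self: "x \<in> M \<Longrightarrow> ceil_in M m x = x"
  using ceil_in_bounds[of x M x m] by auto

lemma open_contains_left_interval:
  fixes d :: "'a::{wellorder, linorder_topology}"
  assumes "open U" "d \<in> U"
  obtains V where "open V" "d \<in> V" "V \<subseteq> {..d}" "\<And>x. x \<in> V \<Longrightarrow> {x..d} \<subseteq> U"
proof (cases "\<exists>w. w < d")
  case True
  then obtain w where "w < d" "{w<..d} \<subseteq> U" using open_left[OF assms] by blast
  moreover have "open ({w<..} \<inter> {..d})" using clopen_atMost[of d] by (intro open_Int) auto
  moreover have "{x..d} \<subseteq> {w<..d}" if "w < x" for x using that by auto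
  ultimately show ?thesis by (intro that[of "{w<..} \<inter> {..d}"]) blast+
next
  case False
  then have "{..d} = {d}" by (auto simp: not_less intro: antisym)
  then show ?thesis using assms(2) clopen_atMost[of d] by (intro that[of "{d}"]) auto
qed

lemma ceil_in_locally_constant:
  fixes d :: "'a::{wellorder, linorder_topology}"
  assumes "\<not> d islimpt M"
  obtains V where "open V" "d \<in> V" "\<And>x. x \<in> V \<Longrightarrow> ceil_in M m x = ceil_in M m d"
proof -
  obtain U where U: "open U" "d \<in> U" "\<And>y. y \<in> M \<Longrightarrow> y \<in> U \<Longrightarrow> y = d"
    using assms unfolding islimpt_def by blast
  obtain V where V: "open V" "d \<in> V" "V \<subseteq> {..d}" "\<And>x. x \<in> V \<Longrightarrow> {x..d} \<subseteq> U"
    using open_contains_left_interval[OF U(1,2)] by blast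
  have "ceil_in M m x = ceil_in M m d" if x: "x \<in> V" for x
  proof -
    have "(\<lambda>y. y \<in> M \<and> x \<le> y) = (\<lambda>y. y \<in> M \<and> d \<le> y)"
      using V(3,4) U(3) x by fastforce
    then show ?thesis unfolding ceil_in_def Bex_def by metis
  qed
  then show ?thesis using that V(1,2) by blast
qed

lemma open_ceil_in_fibre:
  fixes S :: "'a::{wellorder, linorder_topology} set"
  assumes "open S" "\<And>d. d \<in> S \<Longrightarrow> \<not> d islimpt M"
  shows "open {d \<in> S. ceil_in M m d = x}"
proof (subst open_subopen, safe)
  fix d assume d: "d \<in> S"
  obtain V where V: "open V" "d \<in> V" "\<And>y. y \<in> V \<Longrightarrow> ceil_in M m y = ceil_in M m d"
    using ceil_in_locally_constant[OF assms(2)[OF d]] by metis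
  then have "V \<inter> S \<subseteq> {y \<in> S. ceil_in M m y = ceil_in M m d}" by blast
  then show "\<exists>T. open T \<and> d \<in> T \<and> T \<subseteq> {y \<in> S. ceil_in M m y = ceil_in M m d}"
    using V(1,2) assms(1) d by blast
qed

lemma clopen_ceil_in_fibre:
  fixes M :: "'a::{wellorder, linorder_topology} set"
  assumes "finite M" "m \<in> M"
  shows "clopen {d. ceil_in M m d = x}"
proof -
  have "open {d. ceil_in M m d = y}" for y
    using open_ceil_in_fibre[of UNIV M m y] islimpt_finite[OF assms(1)] by simp
  moreover have "- {d. ceil_in M m d = x} = (\<Union>y\<in>M - {x}. {d. ceil_in M m d = y})"
    using ceil_in_mem[OF assms(2)] by auto
  ultimately show ?thesis unfolding closed_def by auto
qed

lemma countable_of_finite_initial_segments: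
  fixes M :: "'a::linorder set"
  assumes "\<And>z. z \<in> M \<Longrightarrow> finite (M \<inter> {..<z})"
  shows "countable M"
proof (rule countableI')
  show "inj_on (\<lambda>z. card (M \<inter> {..<z})) M"
  proof (intro strict_mono_on_imp_inj_on strict_mono_onI)
    fix x y assume "x \<in> M" "y \<in> M" "x < y"
    then show "card (M \<inter> {..<x}) < card (M \<inter> {..<y})"
      using assms by (intro psubset_card_mono) auto
  qed
qed

definition piece_sequence :: "'a::topological_space set \<Rightarrow> 'a set \<Rightarrow> (nat \<Rightarrow> 'a set) \<Rightarrow> bool" where
  "piece_sequence C S K \<longleftrightarrow>
     (\<forall>k. clopen (K k) \<and> (\<exists>x. K k \<inter> C = {x})) \<and> disjoint_family K \<and> (\<Union>k. K k) = S"

lemma piece_sequence_Suc: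
  assumes "piece_sequence C S K"
  shows "piece_sequence C (S - K 0) (\<lambda>k. K (Suc k))"
proof -
  have disj: "disjoint_family K" using assms by (simp add: piece_sequence_def)
  have "(\<Union>k. K k) = K 0 \<union> (\<Union>k. K (Suc k))" by (subst UNIV_nat_eq) auto
  moreover have "K 0 \<inter> (\<Union>k. K (Suc k)) = {}"
    using disj by (auto simp: disjoint_family_on_def)
  ultimately have "(\<Union>k. K (Suc k)) = S - K 0" using assms unfolding piece_sequence_def by blast
  moreover have "disjoint_family (\<lambda>k. K (Suc k))"
    using disj by (simp add: disjoint_family_on_def)
  ultimately show ?thesis using assms by (simp add: piece_sequence_def)
qed

lemma ex_open_homeo_piece_sequence:
  fixes C :: "'a::{wellorder, linorder_topology} set"
  assumes compact: "compact (UNIV :: 'a set)" and C: "homeo_invariant C"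
    and K: "piece_sequence C S K" and L: "piece_sequence C T L"
  obtains h where "open_homeo S T h" "\<And>k. h ` K k = L k"
proof -
  have "\<exists>h. open_homeo (K k) (L k) h" for k
    using K L ex_open_homeo_singleton[OF compact C] unfolding piece_sequence_def by metis
  then obtain h where h: "\<And>k. open_homeo (K k) (L k) (h k)" by metis
  obtain F where F: "open_homeo (\<Union>k. K k) (\<Union>k. L k) F" "\<And>k x. x \<in> K k \<Longrightarrow> F x = h k x"
    by (rule ex_open_homeo_UN[OF h]) (use K L in \<open>auto simp: piece_sequence_def\<close>)
  show thesis
  proof
    show "open_homeo S T F" using F(1) K L by (simp add: piece_sequence_def)
    show "F ` K k = L k" for k using F(2) open_homeoD(5)[OF h[of k]] by (simp cong: image_cong)
  qed
qed

context
  fixes C S :: "'a::{wellorder, linorder_topology} set" and e :: 'a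
  assumes compact_UNIV: "compact (UNIV :: 'a set)"
    and open_S: "open S" and closed_insert: "closed (insert e S)" and e_notin: "e \<notin> S"
    and infinite_S: "infinite (S \<inter> C)" and not_islimpt: "\<And>x. x \<in> S \<Longrightarrow> \<not> x islimpt C"
begin

lemma finite_closed_subset_Int: "closed Z \<Longrightarrow> Z \<subseteq> S \<Longrightarrow> finite (Z \<inter> C)"
  using finite_not_islimpt_in_compact[OF closed_imp_compact[OF compact_UNIV]] not_islimpt by blast

lemma finite_below:
  assumes "z < e"
  shows "finite (S \<inter> C \<inter> {..z})"
proof -
  have "S \<inter> {..z} = insert e S \<inter> {..z}" using assms by auto
  then have "finite (S \<inter> {..z} \<inter> C)"
    using finite_closed_subset_Int closed_insert by (metis closed_Int closed_atMost inf_le1)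
  then show ?thesis by (simp add: Int_ac)
qed

lemma finite_above: "finite (S \<inter> C - {..e})"
proof -
  have "S - {..e} = insert e S - {..e}" by auto
  then have "finite ((S - {..e}) \<inter> C)"
    using finite_closed_subset_Int closed_insert clopen_atMost by (metis Diff_subset closed_Diff)
  then show ?thesis by (simp add: Int_Diff Int_commute)
qed

lemma Int_split_at: "S \<inter> C = S \<inter> C \<inter> {..<e} \<union> (S \<inter> C - {..e})"
  using e_notin by (auto simp: not_le order_le_less)

lemma countable_S_Int: "countable (S \<inter> C)"
proof -
  have "finite (S \<inter> C \<inter> {..<e} \<inter> {..<z})" if "z \<in> S \<inter> C \<inter> {..<e}" for z
    using that by (intro finite_subset[OF _ finite_below[of z]]) auto
  then have "countable (S \<inter> C \<inter> {..<e})" by (rule countable_of_finite_initial_segments)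
  then show ?thesis using finite_above by (subst Int_split_at) (auto intro: countable_finite)
qed

lemma infinite_below: "infinite (S \<inter> C \<inter> {..<e})"
  using infinite_S finite_above by (metis Int_split_at finite_Un)

lemma cofinal_below:
  assumes "d < e"
  obtains x where "x \<in> S \<inter> C" "d < x" "x < e"
proof -
  have "\<not> S \<inter> C \<inter> {..<e} \<subseteq> S \<inter> C \<inter> {..d}"
    using infinite_below finite_below[OF assms] finite_subset by blast
  then obtain x where "x \<in> S \<inter> C \<inter> {..<e}" "x \<notin> S \<inter> C \<inter> {..d}" by blast
  then show ?thesis using that[of x] by (auto simp: not_le)
qed

lemma open_ceil_in_fibre_Int: "open {d \<in> S. ceil_in (S \<inter> C) m d = x}"
  using open_S not_islimpt islimpt_subset by (intro open_ceil_in_fibre) blast+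

lemma closed_ceil_in_fibre_Int:
  assumes x0: "x0 \<in> S \<inter> C" "x0 < e"
  shows "closed {d \<in> S. ceil_in (S \<inter> C) x0 d = x}"
proof -
  define P where "P y = {d \<in> S. ceil_in (S \<inter> C) x0 d = y}" for y
  define W where "W = {if x < e then x else x0<..} \<inter> {..e}"
  have "open W" unfolding W_def using clopen_atMost[of e] by (intro open_Int) auto
  have "e \<in> W" using x0 by (auto simp: W_def)
  have "W \<inter> P x = {}"
  proof safe
    fix d assume d: "d \<in> W" "d \<in> P x"
    then have "d < e" using e_notin by (auto simp: W_def P_def order_le_less)
    then obtain y where "y \<in> S \<inter> C" "d < y" "y < e" using cofinal_below by blast
    then have "d \<le> x" "x \<le> y"
      using ceil_in_bounds[of y "S \<inter> C" d x0] d(2) by (auto simp: P_def)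
    then have "d \<le> x" "x < e" using \<open>y < e\<close> by simp_all
    then show "d \<in> {}" using d(1) by (auto simp: W_def)
  qed
  then have "P x = insert e S - (W \<union> (\<Union>y\<in>S \<inter> C - {x}. P y))"
    using \<open>e \<in> W\<close> ceil_in_mem[OF x0(1)] by (auto simp: P_def)
  moreover have "open (P y)" for y unfolding P_def by (rule open_ceil_in_fibre_Int)
  ultimately have "closed (P x)"
    using closed_insert \<open>open W\<close> by (metis (no_types, lifting) closed_Diff open_UN open_Un)
  then show ?thesis by (simp add: P_def)
qed

lemma ex_piece_sequence: "\<exists>K. piece_sequence C S K"
proof -
  obtain x0 where x0: "x0 \<in> S \<inter> C" "x0 < e"
    using infinite_below by (metis IntE finite.emptyI ex_in_conv lessThan_iff)
  define P where "P x = {d \<in> S. ceil_in (S \<inter> C) x0 d = x}" for x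
  define K where "K k = P (from_nat_into (S \<inter> C) k)" for k
  have enum: "bij_betw (from_nat_into (S \<inter> C)) UNIV (S \<inter> C)"
    using countable_S_Int infinite_S by (rule bij_betw_from_nat_into)
  have mem: "from_nat_into (S \<inter> C) k \<in> S \<inter> C" for k using bij_betwE[OF enum] by simp
  have "clopen (P x) \<and> P x \<inter> C = {x}" if x: "x \<in> S \<inter> C" for x
  proof -
    have "open (P x)" unfolding P_def by (rule open_ceil_in_fibre_Int)
    moreover have "closed (P x)" unfolding P_def by (rule closed_ceil_in_fibre_Int[OF x0])
    moreover have "P x \<inter> C = {x}" using x ceil_in_self[of _ "S \<inter> C" x0] by (auto simp: P_def)
    ultimately show ?thesis by blast
  qed
  then have "clopen (K k)" "\<exists>x. K k \<inter> C = {x}" for k using mem[of k] by (auto simp: K_def)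
  moreover have "disjoint_family K"
    using enum by (auto simp: disjoint_family_on_def K_def P_def bij_betw_def inj_eq)
  moreover have "(\<Union>k. K k) = S"
  proof -
    have "(\<Union>k. K k) = (\<Union>x\<in>S \<inter> C. P x)"
      using enum unfolding K_def bij_betw_def by (metis image_image)
    then show ?thesis using ceil_in_mem[OF x0(1)] by (auto simp: P_def)
  qed
  ultimately show ?thesis unfolding piece_sequence_def by blast
qed

end

section \<open>An infinite swindle\<close>

locale grid_of_copies =
  fixes V D :: "'a::topological_space set"
    and W :: "int \<times> int \<Rightarrow> 'a set" and copy :: "int \<times> int \<Rightarrow> 'a \<Rightarrow> 'a"
  assumes open_homeo_copy: "open_homeo V (W p) (copy p)"
    and copy_origin: "x \<in> V \<Longrightarrow> copy (0, 0) x = x"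
    and W_disjoint: "disjoint_family W"
    and W_cover: "(\<Union>p. W p) = D"
    and extend: "open_homeo D D h \<Longrightarrow> (\<lambda>x. if x \<in> D then h x else x) \<in> supported D"
begin

lemma copy_mem: "x \<in> V \<Longrightarrow> copy p x \<in> W p"
  using open_homeoD(7)[OF open_homeo_copy] .

lemma copy_mem_D: "x \<in> V \<Longrightarrow> copy p x \<in> D"
  using copy_mem W_cover by blast

lemma W_origin: "W (0, 0) = V"
  using open_homeoD(5)[OF open_homeo_copy, of "(0, 0)"] copy_origin by auto

lemma supported_V_subset: "supported V \<subseteq> supported D"
  using W_origin W_cover by (intro supported_mono) blast

lemma supported_D_eqI:
  assumes f: "f \<in> supported D" and g: "g \<in> supported D"
    and eq: "\<And>i j x. x \<in> V \<Longrightarrow> f (copy (i, j) x) = g (copy (i, j) x)"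
  shows "f = g"
proof
  fix y
  show "f y = g y"
  proof (cases "y \<in> D")
    case True
    then obtain p where "y \<in> W p" using W_cover by blast
    then obtain x where "x \<in> V" "y = copy p x"
      using open_homeoD(5)[OF open_homeo_copy[of p]] by blast
    then show ?thesis using eq by (cases p) auto
  qed (use supportedD(2)[OF f] supportedD(2)[OF g] in simp)
qed

lemma ex_supported_wreath:
  assumes "bij r" "\<And>p. open_homeo V V (h p)"
  obtains F where "F \<in> supported D" "\<And>p x. x \<in> V \<Longrightarrow> F (copy p x) = copy (r p) (h p x)"
proof -
  obtain F where F: "open_homeo (\<Union>p. W p) (\<Union>p. W p) F"
      "\<And>p x. x \<in> V \<Longrightarrow> F (copy p x) = copy (r p) (h p x)"
    using ex_open_homeo_wreath[OF open_homeo_copy W_disjoint assms(1), of h] assms(2) by blast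
  show thesis
  proof (rule that)
    show "(\<lambda>x. if x \<in> D then F x else x) \<in> supported D" using extend F(1) W_cover by simp
  qed (use F(2) copy_mem_D in simp)
qed

lemma ex_supported_permutation:
  assumes "bij r"
  obtains s where "s \<in> supported D" "\<And>p x. x \<in> V \<Longrightarrow> s (copy p x) = copy (r p) x"
  using ex_supported_wreath[OF assms open_homeo_id] open_homeoD(1)[OF open_homeo_copy]
  by (metis id_apply)

lemma supported_V_copy:
  assumes f: "f \<in> supported V" and x: "x \<in> V"
  shows "f (copy p x) = (if p = (0, 0) then copy p (f x) else copy p x)"
proof (cases "p = (0, 0)")
  case True
  then show ?thesis using supportedD(3)[OF f] x by (simp add: copy_origin)
next
  case False
  then have "copy p x \<notin> V"
    using copy_mem[OF x, of p] W_disjoint W_origin unfolding disjoint_family_on_def by blast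
  then show ?thesis using supportedD(2)[OF f] False by simp
qed

lemma conj_shift_copy:
  assumes s: "s \<in> carrier Homeo" "\<And>i j x. x \<in> V \<Longrightarrow> s (copy (i, j) x) = copy (i + 1, j) x"
    and g: "\<And>p x. x \<in> V \<Longrightarrow> g (copy p x) = copy p (h p x)"
    and h: "\<And>p x. x \<in> V \<Longrightarrow> h p x \<in> V" and x: "x \<in> V"
  shows "(inv\<^bsub>Homeo\<^esub> (s ^^ k) \<circ> g \<circ> s ^^ k) (copy (i, j) x) = copy (i, j) (h (i + int k, j) x)"
proof -
  have "(s ^^ k) (copy (i, j) y) = copy (i + int k, j) y" if "y \<in> V" for y
    using that s(2) by (induction k) (auto simp: algebra_simps)
  then have "g ((s ^^ k) (copy (i, j) x)) = (s ^^ k) (copy (i, j) (h (i + int k, j) x))"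
    using g h x by simp
  then show ?thesis using Homeo_inv_apply(2)[OF Homeo_funpow[OF s(1)]] by simp
qed

text \<open>Let \<open>g\<close> act as \<open>f i\<close> on the copies \<open>(i, j)\<close> with \<open>i, j \<ge> 0\<close>, let \<open>s\<close> shift the first
  coordinate of all copies, and \<open>t\<close> the second coordinate of the copies \<open>(0, j)\<close> only. The conjugate
  of \<open>g\<close> by \<open>s\<^sup>k\<close> acts as \<open>f k\<close> on the copies \<open>(0, j)\<close> with \<open>j \<ge> 0\<close>, so its commutator with \<open>t\<close>
  telescopes to \<open>f k\<close> on the copy \<open>(0, 0)\<close>.\<close>
lemma supported_V_commutators:
  assumes f: "\<And>k::nat. f k \<in> supported V"
  obtains g s t where "g \<in> carrier Homeo" "s \<in> carrier Homeo" "t \<in> carrier Homeo"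
    "\<And>k. f k \<circ> (t \<circ> (inv\<^bsub>Homeo\<^esub> (s ^^ k) \<circ> g \<circ> s ^^ k)) = inv\<^bsub>Homeo\<^esub> (s ^^ k) \<circ> g \<circ> s ^^ k \<circ> t"
proof -
  have V: "open V" using open_homeoD(1)[OF open_homeo_copy] .
  define h where "h = (\<lambda>(i::int, j::int). if i \<ge> 0 \<and> j \<ge> 0 then f (nat i) else id)"
  have h: "open_homeo V V (h p)" for p
    using supported_open_homeo[OF f V] open_homeo_id[OF V] by (auto simp: h_def split: prod.split)
  have h_mem: "h p x \<in> V" if "x \<in> V" for p x using open_homeoD(7)[OF h that] .
  have "bij (\<lambda>(i::int, j::int). (i + 1, j))"
    by (rule bij_betw_byWitness[where f' = "\<lambda>(i, j). (i - 1, j)"]) auto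
  then obtain s where s: "s \<in> supported D" "\<And>i j x. x \<in> V \<Longrightarrow> s (copy (i, j) x) = copy (i + 1, j) x"
    using ex_supported_permutation by (metis case_prod_conv)
  define up :: "int \<times> int \<Rightarrow> int \<times> int" where "up = (\<lambda>(i, j). (i, if i = 0 then j + 1 else j))"
  have "bij up" unfolding up_def
    by (rule bij_betw_byWitness[where f' = "\<lambda>(i, j). (i, if i = 0 then j - 1 else j)"]) auto
  then obtain t where t: "t \<in> supported D" "\<And>p x. x \<in> V \<Longrightarrow> t (copy p x) = copy (up p) x"
    using ex_supported_permutation by blast
  obtain g where g: "g \<in> supported D" "\<And>p x. x \<in> V \<Longrightarrow> g (copy p x) = copy p (h p x)"
    using ex_supported_wreath[OF bij_id h] by (metis id_apply)
  have "f k \<circ> (t \<circ> (inv\<^bsub>Homeo\<^esub> (s ^^ k) \<circ> g \<circ> s ^^ k)) = inv\<^bsub>Homeo\<^esub> (s ^^ k) \<circ> g \<circ> s ^^ k \<circ> t"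
    (is "f k \<circ> (t \<circ> ?w) = ?w \<circ> t") for k
  proof (rule supported_D_eqI)
    have "f k \<in> supported D" using supported_V_subset f by blast
    then show "f k \<circ> (t \<circ> ?w) \<in> supported D" "?w \<circ> t \<in> supported D"
      using s(1) t(1) g(1) by (simp_all add: supported_comp supported_inv supported_funpow)
    fix i j x assume x: "x \<in> V"
    note w_copy = conj_shift_copy[OF supportedD(1)[OF s(1)] s(2) g(2) h_mem x]
    obtain j' where up: "up (i, j) = (i, j')" by (simp add: up_def)
    have "(f k \<circ> (t \<circ> ?w)) (copy (i, j) x) = f k (copy (i, j') (h (i + int k, j) x))"
      using w_copy t(2)[OF h_mem[OF x]] by (simp add: up)
    also have "\<dots> = copy (i, j') (h (i + int k, j') x)"
      unfolding supported_V_copy[OF f h_mem[OF x]] using up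
      by (auto simp: up_def h_def split: if_splits)
    also have "\<dots> = (?w \<circ> t) (copy (i, j) x)"
      using w_copy t(2)[OF x] by (simp add: up)
    finally show "(f k \<circ> (t \<circ> ?w)) (copy (i, j) x) = (?w \<circ> t) (copy (i, j) x)" .
  qed
  then show thesis using supportedD(1) g(1) s(1) t(1) that by blast
qed

lemma strongly_bounded_supported_V: "strongly_bounded Homeo (supported V)"
proof (rule Homeo.strongly_boundedI_commutators)
  fix f :: "nat \<Rightarrow> 'a \<Rightarrow> 'a"
  assume "range f \<subseteq> supported V"
  then have "f k \<in> supported V" for k by blast
  then obtain g s t where "g \<in> carrier Homeo" "s \<in> carrier Homeo" "t \<in> carrier Homeo"
    "\<And>k. f k \<circ> (t \<circ> (inv\<^bsub>Homeo\<^esub> (s ^^ k) \<circ> g \<circ> s ^^ k)) = inv\<^bsub>Homeo\<^esub> (s ^^ k) \<circ> g \<circ> s ^^ k \<circ> t"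
    using supported_V_commutators[of f] by blast
  then show "\<exists>g\<in>carrier Homeo. \<exists>s\<in>carrier Homeo. \<exists>t\<in>carrier Homeo. \<forall>k::nat.
      f k \<circ> (t \<circ> (inv\<^bsub>Homeo\<^esub> (s [^]\<^bsub>Homeo\<^esub> k) \<circ> g \<circ> s [^]\<^bsub>Homeo\<^esub> k)) =
      inv\<^bsub>Homeo\<^esub> (s [^]\<^bsub>Homeo\<^esub> k) \<circ> g \<circ> s [^]\<^bsub>Homeo\<^esub> k \<circ> t"
    unfolding pow_Homeo by blast
qed (use subgroup.subset[OF subgroup_supported] in blast)

end

lemma ex_vimage_infinite_fibres:
  fixes I :: "'a::countable set" and p0 :: "'b::countable"
  assumes I: "infinite I" "infinite (- I)" and "p \<noteq> p0"
  obtains q :: "'a \<Rightarrow> 'b" where "q -` {p0} = I" "\<And>p. infinite (q -` {p})"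
proof -
  define M where "M = (- {p0}) \<times> (UNIV :: nat set)"
  have "infinite M" using assms(3) by (auto simp: M_def finite_cartesian_product_iff)
  then obtain g where g: "bij_betw g (- I) M"
    using to_nat_on_infinite[OF _ I(2)] bij_betw_from_nat_into[of M] bij_betw_trans
    by (metis countableI_type)
  define q where "q k = (if k \<in> I then p0 else fst (g k))" for k
  have fst_g: "fst (g k) \<noteq> p0" if "k \<notin> I" for k
    using bij_betwE[OF g] that by (auto simp: M_def mem_Times_iff)
  have "infinite (q -` {p})" if p: "p \<noteq> p0" for p
  proof
    assume "finite (q -` {p})"
    moreover have "{p} \<times> UNIV \<subseteq> g ` (q -` {p})"
    proof
      fix y assume y: "y \<in> {p} \<times> (UNIV :: nat set)"
      then have "y \<in> M" using p by (auto simp: M_def)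
      then obtain k where "k \<notin> I" "g k = y" using g unfolding bij_betw_def by blast
      then show "y \<in> g ` (q -` {p})" using y by (auto simp: q_def)
    qed
    ultimately have "finite ({p} \<times> (UNIV :: nat set))" using finite_surj by blast
    then show False by (simp add: finite_cartesian_product_iff)
  qed
  moreover have "q -` {p0} = I" using fst_g by (auto simp: q_def) metis
  ultimately show thesis using that I(1) by metis
qed

section \<open>Clopen subsets of the punctured sets \<open>Y e - {e}\<close>\<close>

definition clopen_in :: "'a::topological_space set \<Rightarrow> 'a set \<Rightarrow> bool" where
  "clopen_in D S \<longleftrightarrow> S \<subseteq> D \<and> open S \<and> open (D - S)"

lemma clopen_in_self: "open D \<Longrightarrow> clopen_in D D"
  by (simp add: clopen_in_def)

lemma clopen_in_Diff:
  assumes "clopen_in D S" "clopen_in D T"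
  shows "clopen_in D (S - T)"
proof -
  have "S - T = S \<inter> (D - T)" "D - (S - T) = (D - S) \<union> T"
    using assms by (auto simp: clopen_in_def)
  then show ?thesis using assms by (auto simp: clopen_in_def)
qed

lemma clopen_in_Int:
  assumes "clopen_in D S" "clopen_in D T"
  shows "clopen_in D (S \<inter> T)"
  using clopen_in_Diff[OF assms(1) clopen_in_Diff[OF assms]] by (simp add: Diff_Diff_Int)

lemma clopen_in_supported_image:
  assumes h: "h \<in> supported D" and S: "clopen_in D S"
  shows "clopen_in D (h ` S)"
proof -
  have "D - h ` S = h ` (D - S)"
    using Homeo_inj[OF supportedD(1)[OF h]] supportedD(4)[OF h] by (simp add: image_set_diff)
  then show ?thesis
    using S supportedD(3)[OF h] Homeo_open_image[OF supportedD(1)[OF h]]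
    by (auto simp: clopen_in_def)
qed

lemma clopen_in_supported_vimage:
  assumes h: "h \<in> supported D" and S: "clopen_in D S"
  shows "clopen_in D (h -` S)"
proof -
  have "D - h -` S = h -` (D - S)" using supportedD(3)[OF h] by auto
  then show ?thesis
    using S supportedD(3)[OF h] Homeo_open_vimage[OF supportedD(1)[OF h]]
    by (auto simp: clopen_in_def)
qed

locale finite_derived_set =
  fixes C :: "'a::{wellorder, linorder_topology} set"
  assumes compact_UNIV: "compact (UNIV :: 'a set)"
    and invariant: "homeo_invariant C"
    and finite_limit_points: "finite {x. x islimpt C}"
    and ex_limit_point: "\<exists>x. x islimpt C"
begin

definition E :: "'a set" where
  "E = {x. x islimpt C}"

definition Y :: "'a \<Rightarrow> 'a set" where
  "Y e = {x. ceil_in E (Max E) x = e}"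

definition punctured :: "'a \<Rightarrow> 'a set" where
  "punctured e = Y e - {e}"

definition big :: "'a \<Rightarrow> 'a set \<Rightarrow> bool" where
  "big e S \<longleftrightarrow> clopen_in (punctured e) S \<and> infinite (S \<inter> C)"

lemma finite_E: "finite E"
  using finite_limit_points by (simp add: E_def)

lemma Max_E_mem: "Max E \<in> E"
  using finite_E ex_limit_point by (intro Max_in) (auto simp: E_def)

lemma Homeo_mem_C_iff: "h \<in> carrier Homeo \<Longrightarrow> h x \<in> C \<longleftrightarrow> x \<in> C"
  using homeo_invariant_iff[OF invariant] by (simp add: carrier_Homeo)

lemma Homeo_mem_E_iff: "h \<in> carrier Homeo \<Longrightarrow> h x \<in> E \<longleftrightarrow> x \<in> E"
  using homeo_invariant_iff[OF homeo_invariant_limit_points[OF invariant]]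
  by (simp add: carrier_Homeo E_def)

lemma finite_Int_C: "closed Z \<Longrightarrow> Z \<inter> E = {} \<Longrightarrow> finite (Z \<inter> C)"
  using closed_imp_compact[OF compact_UNIV]
  by (intro finite_not_islimpt_in_compact) (auto simp: E_def)

lemma clopen_Y: "clopen (Y e)"
  unfolding Y_def using finite_E Max_E_mem by (rule clopen_ceil_in_fibre)

lemma Y_mem: "e \<in> E \<Longrightarrow> e \<in> Y e"
  by (simp add: Y_def ceil_in_self)

lemma Y_disjoint: "e \<noteq> e' \<Longrightarrow> Y e \<inter> Y e' = {}"
  by (auto simp: Y_def)

lemma Y_cover: obtains e where "e \<in> E" "x \<in> Y e"
  using ceil_in_mem[OF Max_E_mem] by (auto simp: Y_def)

lemma mem_E_Y_eq: "x \<in> E \<Longrightarrow> x \<in> Y e \<Longrightarrow> x = e"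
  by (simp add: Y_def ceil_in_self)

lemma open_punctured: "open (punctured e)"
  using clopen_Y by (auto simp: punctured_def)

lemma insert_punctured: "e \<in> E \<Longrightarrow> insert e (punctured e) = Y e"
  using Y_mem by (auto simp: punctured_def)

lemma not_islimpt_punctured: "x \<in> punctured e \<Longrightarrow> \<not> x islimpt C"
  using mem_E_Y_eq[of x e] by (auto simp: punctured_def E_def)

lemma supported_Y_eq_supported_punctured: "e \<in> E \<Longrightarrow> supported (Y e) = supported (punctured e)"
proof
  assume e: "e \<in> E"
  show "supported (Y e) \<subseteq> supported (punctured e)"
  proof
    fix h assume h: "h \<in> supported (Y e)"
    have "h e = e"
      using mem_E_Y_eq Homeo_mem_E_iff[OF supportedD(1)[OF h]] supportedD(3)[OF h] Y_mem e by simp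
    then show "h \<in> supported (punctured e)" using h by (auto simp: supported_def punctured_def)
  qed
  show "supported (punctured e) \<subseteq> supported (Y e)"
    by (rule supported_mono) (simp add: punctured_def)
qed

lemma extend_supported_punctured:
  assumes e: "e \<in> E" and h: "open_homeo (punctured e) (punctured e) h"
  shows "(\<lambda>x. if x \<in> punctured e then h x else x) \<in> supported (punctured e)" (is "?h \<in> _")
proof -
  have "open_homeo (punctured e) (punctured e) ?h" by (rule open_homeo_cong[OF h]) simp
  then have "open_homeo (insert e (punctured e)) (insert (?h e) (punctured e)) ?h"
    by (rule open_homeo_insert)
      (use insert_punctured[OF e] clopen_Y closed_imp_compact[OF compact_UNIV] in
        \<open>auto simp: punctured_def\<close>)
  then have "open_homeo (Y e) (Y e) ?h"
    using insert_punctured[OF e] by (simp add: punctured_def)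
  then have "(\<lambda>x. if x \<in> Y e then ?h x else x) \<in> supported (Y e)"
    using clopen_Y by (intro extend_by_id_supported) auto
  moreover have "(\<lambda>x. if x \<in> Y e then ?h x else x) = ?h" by (auto simp: punctured_def)
  ultimately show ?thesis using supported_Y_eq_supported_punctured[OF e] by simp
qed

lemma extend_supported:
  assumes e: "e \<in> E" and S: "clopen_in (punctured e) S" and h: "open_homeo S S h"
  shows "(\<lambda>x. if x \<in> S then h x else x) \<in> supported S" (is "?h \<in> _")
proof -
  have "open_homeo (S \<union> (punctured e - S)) (S \<union> (punctured e - S))
      (\<lambda>x. if x \<in> S then h x else id x)"
    by (rule open_homeo_Un[OF h open_homeo_id]) (use S in \<open>auto simp: clopen_in_def\<close>)
  moreover have "S \<union> (punctured e - S) = punctured e" using S by (auto simp: clopen_in_def)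
  ultimately have "open_homeo (punctured e) (punctured e) ?h" unfolding id_apply by metis
  then have "(\<lambda>x. if x \<in> punctured e then ?h x else x) \<in> supported (punctured e)"
    by (rule extend_supported_punctured[OF e])
  moreover have "(\<lambda>x. if x \<in> punctured e then ?h x else x) = ?h"
    using S by (auto simp: clopen_in_def fun_eq_iff)
  ultimately show ?thesis by (simp add: supported_def)
qed

lemma bigI: "clopen_in (punctured e) S \<Longrightarrow> infinite M \<Longrightarrow> M \<subseteq> S \<inter> C \<Longrightarrow> big e S"
  unfolding big_def using finite_subset by blast

lemma big_punctured:
  assumes e: "e \<in> E"
  shows "big e (punctured e)"
proof (rule bigI)
  show "infinite (Y e \<inter> C - {e})"
    using e Y_mem[OF e] clopen_Y[of e] by (auto simp: E_def islimpt_eq_acc_point Int_commute)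
qed (auto simp: punctured_def clopen_in_self open_punctured[unfolded punctured_def])

lemma ex_piece_sequence_big:
  assumes e: "e \<in> E" and S: "big e S"
  shows "\<exists>K. piece_sequence C S K"
proof (rule ex_piece_sequence[OF compact_UNIV])
  have sub: "S \<subseteq> punctured e" using S by (simp add: big_def clopen_in_def)
  then have "insert e S = Y e - (punctured e - S)" using Y_mem[OF e] by (auto simp: punctured_def)
  then show "closed (insert e S)" using S clopen_Y[of e] by (auto simp: big_def clopen_in_def)
  show "e \<notin> S" using sub by (auto simp: punctured_def)
  show "\<not> x islimpt C" if "x \<in> S" for x using that sub not_islimpt_punctured by blast
qed (use S in \<open>auto simp: big_def clopen_in_def\<close>)

lemma ex_open_homeo_big:
  assumes "e \<in> E" "big e S" "big e T"
  shows "\<exists>h. open_homeo S T h"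
  using ex_piece_sequence_big[OF assms(1,2)] ex_piece_sequence_big[OF assms(1,3)]
    ex_open_homeo_piece_sequence[OF compact_UNIV invariant] by metis

lemma ex_supported_extension:
  assumes e: "e \<in> E" and T: "clopen_in (punctured e) T" and u: "open_homeo A A' u"
    and A: "A \<subseteq> T" "big e (T - A)" and A': "A' \<subseteq> T" "big e (T - A')"
  obtains g where "g \<in> supported T" "\<And>x. x \<in> A \<Longrightarrow> g x = u x"
proof -
  obtain v where v: "open_homeo (T - A) (T - A') v" using ex_open_homeo_big e A(2) A'(2) by blast
  have "open_homeo (A \<union> (T - A)) (A' \<union> (T - A')) (\<lambda>x. if x \<in> A then u x else v x)"
    by (rule open_homeo_Un[OF u v]) auto
  then have "open_homeo T T (\<lambda>x. if x \<in> A then u x else v x)"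
    using A(1) A'(1) by (simp add: Un_absorb1)
  then have "(\<lambda>x. if x \<in> T then if x \<in> A then u x else v x else x) \<in> supported T"
    by (rule extend_supported[OF e T])
  then show thesis by (rule that) (use A(1) in auto)
qed

lemma supported_punctured_factor:
  assumes e: "e \<in> E" and h: "h \<in> supported (punctured e)" and T: "clopen_in (punctured e) T"
    and A: "big e A" "A \<subseteq> T" "big e (T - A)" and hA: "h ` A \<subseteq> T" "big e (T - h ` A)"
    and S: "big e S" "S \<subseteq> T" "big e (T - S)"
  shows "h \<in> supported T <#>\<^bsub>Homeo\<^esub> supported (punctured e - S) <#>\<^bsub>Homeo\<^esub> supported T"
proof -
  have hH: "h \<in> carrier Homeo" using supportedD(1)[OF h] .
  obtain g where g: "g \<in> supported T" "\<And>x. x \<in> A \<Longrightarrow> g x = h x"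
    using ex_supported_extension[OF e T Homeo_open_homeo[OF hH] A(2,3) hA] A(1)
    by (auto simp: big_def clopen_in_def)
  obtain u where u: "open_homeo A S u" using ex_open_homeo_big[OF e A(1) S(1)] by blast
  obtain t where t: "t \<in> supported T" "\<And>x. x \<in> A \<Longrightarrow> t x = u x"
    using ex_supported_extension[OF e T u A(2,3) S(2,3)] by blast
  have gH: "g \<in> carrier Homeo" and tH: "t \<in> carrier Homeo" using supportedD(1) g(1) t(1) by blast+
  define w where "w = t \<circ> inv\<^bsub>Homeo\<^esub> g \<circ> h \<circ> inv\<^bsub>Homeo\<^esub> t"
  have "supported T \<subseteq> supported (punctured e)"
    using T by (intro supported_mono) (simp add: clopen_in_def)
  then have w: "w \<in> supported (punctured e)"
    unfolding w_def using g(1) t(1) h by (intro supported_comp supported_inv) blast+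
  have "w x = x" if "x \<in> S" for x
  proof -
    obtain a where a: "a \<in> A" "x = u a" using \<open>x \<in> S\<close> open_homeoD(5)[OF u] by blast
    then have "x = t a" "h a = g a" using g(2) t(2) by simp_all
    then show ?thesis by (simp add: w_def Homeo_inv_apply gH tH)
  qed
  then have "w \<in> supported (punctured e - S)" using w by (auto simp: supported_def)
  moreover have "h = g \<circ> inv\<^bsub>Homeo\<^esub> t \<circ> w \<circ> t"
    by (simp add: w_def fun_eq_iff Homeo_inv_apply gH tH)
  moreover have "g \<circ> inv\<^bsub>Homeo\<^esub> t \<in> supported T"
    using g(1) t(1) by (intro supported_comp supported_inv)
  ultimately show ?thesis using t(1) unfolding set_mult_def mult_Homeo by blast
qed

definition K :: "'a \<Rightarrow> nat \<Rightarrow> 'a set" where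
  "K e = (SOME K. piece_sequence C (punctured e) K)"

definition pt :: "'a \<Rightarrow> nat \<Rightarrow> 'a" where
  "pt e k = (THE x. K e k \<inter> C = {x})"

definition pieces :: "'a \<Rightarrow> nat set \<Rightarrow> 'a set" where
  "pieces e I = (\<Union>k\<in>I. K e k)"

lemma piece_sequence_K: "e \<in> E \<Longrightarrow> piece_sequence C (punctured e) (K e)"
  unfolding K_def using someI_ex[OF ex_piece_sequence_big[OF _ big_punctured]] by simp

lemma clopen_K: "e \<in> E \<Longrightarrow> clopen (K e k)"
  using piece_sequence_K unfolding piece_sequence_def by blast

lemma K_Int_C: "e \<in> E \<Longrightarrow> K e k \<inter> C = {pt e k}"
  unfolding pt_def by (rule theI') (use piece_sequence_K in \<open>auto simp: piece_sequence_def\<close>)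

lemma pt_mem: "e \<in> E \<Longrightarrow> pt e k \<in> K e k" "e \<in> E \<Longrightarrow> pt e k \<in> C"
  using K_Int_C by blast+

lemma K_unique: "e \<in> E \<Longrightarrow> x \<in> K e k \<Longrightarrow> x \<in> K e j \<Longrightarrow> k = j"
  using piece_sequence_K unfolding piece_sequence_def disjoint_family_on_def by blast

lemma inj_pt: "e \<in> E \<Longrightarrow> inj (pt e)"
  by (rule injI) (metis K_unique pt_mem(1))

lemma pieces_UNIV: "e \<in> E \<Longrightarrow> pieces e UNIV = punctured e"
  using piece_sequence_K by (simp add: pieces_def piece_sequence_def)

lemma K_subset: "e \<in> E \<Longrightarrow> K e k \<subseteq> punctured e"
  using pieces_UNIV unfolding pieces_def by blast

lemma pieces_subset: "e \<in> E \<Longrightarrow> pieces e I \<subseteq> punctured e"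
  using K_subset unfolding pieces_def by blast

lemma pieces_Diff: "e \<in> E \<Longrightarrow> pieces e (I - J) = pieces e I - pieces e J"
  unfolding pieces_def by (auto dest: K_unique)

lemma pieces_Compl: "e \<in> E \<Longrightarrow> pieces e (- J) = punctured e - pieces e J"
  by (metis Compl_eq_Diff_UNIV pieces_Diff pieces_UNIV)

lemma pt_mem_pieces_iff: "e \<in> E \<Longrightarrow> pt e k \<in> pieces e I \<longleftrightarrow> k \<in> I"
  using pt_mem(1) K_unique unfolding pieces_def by blast

lemma pieces_Int_C: "e \<in> E \<Longrightarrow> pieces e I \<inter> C = pt e ` I"
  using K_Int_C unfolding pieces_def by auto

lemma open_pieces: "e \<in> E \<Longrightarrow> open (pieces e I)"
  unfolding pieces_def using clopen_K by blast

lemma closed_pieces: "e \<in> E \<Longrightarrow> finite I \<Longrightarrow> closed (pieces e I)"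
  unfolding pieces_def using clopen_K by blast

lemma clopen_in_pieces: "e \<in> E \<Longrightarrow> clopen_in (punctured e) (pieces e I)"
  using pieces_subset open_pieces pieces_Compl[of e I] by (metis clopen_in_def)

lemma big_pieces: "e \<in> E \<Longrightarrow> infinite I \<Longrightarrow> big e (pieces e I)"
  using inj_pt[of e] clopen_in_pieces
  by (simp add: big_def pieces_Int_C finite_image_iff inj_on_subset)

lemma eventually_K_subset:
  assumes e: "e \<in> E" and U: "open U" "e \<in> U"
  shows "\<forall>\<^sub>F k in sequentially. K e k \<subseteq> U"
proof -
  have "compact (Y e - U)" using clopen_Y U(1) by (auto intro: closed_imp_compact[OF compact_UNIV])
  moreover have "Y e - U \<subseteq> (\<Union>k\<in>UNIV. K e k)"
    using pieces_UNIV[OF e] U(2) by (auto simp: pieces_def punctured_def)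
  ultimately obtain J where J: "finite J" "Y e - U \<subseteq> (\<Union>k\<in>J. K e k)"
    using clopen_K[OF e] by (metis compactE_image)
  obtain n where n: "\<forall>j\<in>J. j < n" using J(1) finite_nat_set_iff_bounded by blast
  have "K e k \<subseteq> U" if "n \<le> k" for k
  proof
    fix x assume x: "x \<in> K e k"
    then have "x \<in> Y e" using K_subset[OF e] by (auto simp: punctured_def)
    moreover have "x \<notin> K e j" if "j \<in> J" for j
      using K_unique[OF e x, of j] n that \<open>n \<le> k\<close> by auto
    ultimately show "x \<in> U" using J(2) by blast
  qed
  then show ?thesis unfolding eventually_sequentially by blast
qed

end

section \<open>Strong boundedness of the homeomorphisms supported on \<open>Y e\<close>\<close>

context finite_derived_set
begin

lemma grid_of_copies_pieces:
  assumes e: "e \<in> E" and I: "infinite I" "infinite (- I)"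
  obtains W copy where "grid_of_copies (pieces e I) (punctured e) W copy"
proof -
  obtain q :: "nat \<Rightarrow> int \<times> int" where q: "q -` {(0, 0)} = I" "\<And>p. infinite (q -` {p})"
    by (rule ex_vimage_infinite_fibres[OF I, of "(1, 0)" "(0, 0)"]) auto
  define W where "W p = pieces e (q -` {p})" for p
  have "\<exists>h. open_homeo (pieces e I) (W p) h" for p
    unfolding W_def using big_pieces[OF e] I(1) q(2) by (intro ex_open_homeo_big[OF e]) blast+
  then obtain h where h: "\<And>p. open_homeo (pieces e I) (W p) (h p)" by metis
  show thesis
  proof (rule that, unfold_locales)
    show "open_homeo (pieces e I) (W p) ((h((0, 0) := id)) p)" for p
      using h open_homeo_id[OF open_pieces[OF e]] q(1) by (auto simp: W_def)
    show "disjoint_family W"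
      using K_unique[OF e] by (fastforce simp: disjoint_family_on_def W_def pieces_def)
    show "(\<Union>p. W p) = punctured e"
    proof -
      have "(\<Union>p. q -` {p}) = UNIV" by auto
      then show ?thesis
        using pieces_UNIV[OF e] unfolding W_def pieces_def UN_UN_flatten[symmetric] by simp
    qed
  qed (use extend_supported_punctured[OF e] in auto)
qed

lemma strongly_bounded_supported_pieces:
  assumes "e \<in> E" "infinite I" "infinite (- I)"
  shows "strongly_bounded Homeo (supported (pieces e I))"
  using grid_of_copies_pieces[OF assms] grid_of_copies.strongly_bounded_supported_V by metis

lemma ex_big_subset_mapped_into:
  assumes e: "e \<in> E" and h: "h \<in> supported (punctured e)" and T: "clopen_in (punctured e) T"
    and inf: "infinite {k \<in> P. h (pt e k) \<in> T}"
  obtains A where "big e A" "A \<subseteq> pieces e P" "h ` A \<subseteq> T" "big e (T - h ` A)"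
proof -
  obtain I J where IJ: "I \<subseteq> {k \<in> P. h (pt e k) \<in> T}" "J \<subseteq> {k \<in> P. h (pt e k) \<in> T}"
    and I: "infinite I" and J: "infinite J" "I \<inter> J = {}"
    by (rule infinite_split[OF inf])
  define A where "A = pieces e I \<inter> h -` T"
  have A: "clopen_in (punctured e) A"
    unfolding A_def
    by (intro clopen_in_Int clopen_in_pieces[OF e] clopen_in_supported_vimage[OF h T])
  have pt_A: "pt e k \<in> A \<longleftrightarrow> k \<in> I" for k
    using IJ(1) pt_mem_pieces_iff[OF e] by (auto simp: A_def)
  have inj_h: "inj h" using Homeo_inj[OF supportedD(1)[OF h]] .
  show thesis
  proof (rule that[of A])
    show "big e A"
      using A by (rule bigI[of e A "pt e ` I"])
        (use I inj_pt[OF e] pt_A pt_mem(2)[OF e] in \<open>auto simp: finite_image_iff inj_on_subset\<close>)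
    show "A \<subseteq> pieces e P" "h ` A \<subseteq> T" using IJ(1) by (auto simp: A_def pieces_def)
    show "big e (T - h ` A)"
    proof (rule bigI[of e _ "h ` pt e ` J"])
      show "clopen_in (punctured e) (T - h ` A)"
        using T clopen_in_supported_image[OF h A] by (rule clopen_in_Diff)
      show "infinite (h ` pt e ` J)"
        using J(1) inj_h inj_pt[OF e] by (simp add: finite_image_iff inj_on_subset)
      show "h ` pt e ` J \<subseteq> (T - h ` A) \<inter> C"
        using IJ(2) J(2) pt_A inj_h Homeo_mem_C_iff[OF supportedD(1)[OF h]] pt_mem(2)[OF e]
        by (auto simp: inj_eq disjoint_iff)
    qed
  qed
qed

definition pieces_factors :: "'a \<Rightarrow> nat set \<Rightarrow> nat set \<Rightarrow> ('a \<Rightarrow> 'a) set" where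
  "pieces_factors e P Q = supported (pieces e (P \<union> Q)) <#>\<^bsub>Homeo\<^esub> supported (pieces e (- P))
     <#>\<^bsub>Homeo\<^esub> supported (pieces e (P \<union> Q))"

lemma strongly_bounded_pieces_factors:
  assumes e: "e \<in> E" and P: "infinite P" and Q: "infinite Q" "P \<inter> Q = {}" and "infinite (- (P \<union> Q))"
  shows "strongly_bounded Homeo (pieces_factors e P Q)"
proof -
  have "infinite (- P)" by (rule infinite_super[OF _ Q(1)]) (use Q(2) in blast)
  then show ?thesis
    unfolding pieces_factors_def using P assms(5)
    by (intro Homeo.strongly_bounded_set_mult strongly_bounded_supported_pieces[OF e]) simp_all
qed

lemma mem_pieces_factors:
  assumes e: "e \<in> E" and h: "h \<in> supported (punctured e)"
    and Q: "infinite Q" "P \<inter> Q = {}" and inf: "infinite {k \<in> P. h (pt e k) \<in> pieces e (P \<union> Q)}"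
  shows "h \<in> pieces_factors e P Q"
proof -
  define T where "T = pieces e (P \<union> Q)"
  have T: "clopen_in (punctured e) T" unfolding T_def by (rule clopen_in_pieces[OF e])
  obtain A where A: "big e A" "A \<subseteq> pieces e P" "h ` A \<subseteq> T" "big e (T - h ` A)"
    using ex_big_subset_mapped_into[OF e h T inf[folded T_def]] by blast
  have "pieces e Q = pieces e Q - pieces e P"
    using pieces_Diff[OF e, of Q P] Q(2) by (simp add: Diff_triv Int_commute)
  then have T_Diff: "T - pieces e P = pieces e Q" and P_T: "pieces e P \<subseteq> T"
    by (auto simp: T_def pieces_def)
  have big_Q: "big e (pieces e Q)" using big_pieces[OF e Q(1)] .
  have "big e (T - A)"
  proof (rule bigI)
    show "clopen_in (punctured e) (T - A)"
      using T A(1) unfolding big_def by (intro clopen_in_Diff) simp_all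
    show "infinite (pieces e Q \<inter> C)" using big_Q by (simp add: big_def)
    show "pieces e Q \<inter> C \<subseteq> (T - A) \<inter> C" using T_Diff A(2) by blast
  qed
  moreover have "big e (pieces e P)"
  proof (rule big_pieces[OF e])
    show "infinite P" by (rule infinite_super[OF _ inf]) blast
  qed
  moreover have "A \<subseteq> T" using A(2) P_T by blast
  ultimately have "h \<in> supported T <#>\<^bsub>Homeo\<^esub> supported (punctured e - pieces e P)
      <#>\<^bsub>Homeo\<^esub> supported T"
    using A big_Q P_T by (intro supported_punctured_factor[OF e h T, of A]) (simp_all add: T_Diff)
  then show ?thesis by (simp add: pieces_factors_def T_def pieces_Compl[OF e])
qed

lemma supported_punctured_subset_pieces_factors:
  assumes e: "e \<in> E" and P: "infinite P" and Q: "infinite Q" "P \<inter> Q = {}"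
    and R: "infinite R" "P \<inter> R = {}" and cover: "P \<union> Q \<union> R = UNIV"
  shows "supported (punctured e) \<subseteq> pieces_factors e P Q \<union> pieces_factors e P R"
proof
  fix h assume h: "h \<in> supported (punctured e)"
  define hits where "hits M = {k \<in> P. h (pt e k) \<in> pieces e (P \<union> M)}" for M
  have "h (pt e k) \<in> pieces e (P \<union> Q) \<union> pieces e (P \<union> R)" for k
  proof -
    have "h (pt e k) \<in> pieces e UNIV"
      using supportedD(3)[OF h] pt_mem(1)[OF e] K_subset[OF e] pieces_UNIV[OF e] by blast
    then show ?thesis unfolding cover[symmetric] pieces_def by blast
  qed
  then have "P \<subseteq> hits Q \<union> hits R" unfolding hits_def by blast
  then have "infinite (hits Q \<union> hits R)" using P by (rule infinite_super)
  then consider "infinite (hits Q)" | "infinite (hits R)" unfolding finite_Un by blast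
  then show "h \<in> pieces_factors e P Q \<union> pieces_factors e P R"
    unfolding hits_def
    by cases (use mem_pieces_factors[OF e h Q] mem_pieces_factors[OF e h R] in simp_all)
qed

lemma strongly_bounded_supported_Y:
  assumes e: "e \<in> E"
  shows "strongly_bounded Homeo (supported (Y e))"
proof -
  obtain P B :: "nat set" where "P \<subseteq> UNIV" "B \<subseteq> UNIV" and P: "infinite P"
    and B: "infinite B" "P \<inter> B = {}"
    by (rule infinite_split[OF infinite_UNIV_nat])
  obtain Q B' where Q: "Q \<subseteq> B" and B': "B' \<subseteq> B" and inf: "infinite Q" "infinite B'"
    and disj: "Q \<inter> B' = {}"
    by (rule infinite_split[OF B(1)])
  define R where "R = - (P \<union> Q)"
  have R: "infinite R"
    by (rule infinite_super[OF _ inf(2)]) (use B' B(2) disj in \<open>auto simp: R_def\<close>)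
  have PQR: "P \<inter> Q = {}" "P \<inter> R = {}" "P \<union> Q \<union> R = UNIV" "- (P \<union> R) = Q"
    using Q B(2) by (auto simp: R_def)
  have "strongly_bounded Homeo (pieces_factors e P Q \<union> pieces_factors e P R)"
    using P inf(1) R PQR R_def
    by (intro Homeo.strongly_bounded_Un strongly_bounded_pieces_factors[OF e]) simp_all
  then show ?thesis
    unfolding supported_Y_eq_supported_punctured[OF e]
    using supported_punctured_subset_pieces_factors[OF e P inf(1) PQR(1) R PQR(2,3)]
    by (rule Homeo.strongly_bounded_subset)
qed

end

section \<open>Generation of the homeomorphism group\<close>

context finite_derived_set
begin

definition shifts :: "'a \<Rightarrow> ('a \<Rightarrow> 'a) \<Rightarrow> bool" where
  "shifts e s \<longleftrightarrow> s \<in> carrier Homeo \<and> s e = e \<and> (\<forall>k. s ` K e k = K e (Suc k))"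

lemma shifts_image_Y:
  assumes e: "e \<in> E" and s: "shifts e s"
  shows "(s ^^ n) ` Y e = Y e - pieces e {..<n}"
proof (induction n)
  case 0
  then show ?case by (simp add: pieces_def)
next
  case (Suc n)
  have image_pieces: "s ` pieces e I = pieces e (Suc ` I)" for I
    using s by (auto simp: pieces_def shifts_def image_UN)
  have "s ` Y e = s ` insert e (pieces e UNIV)"
    using insert_punctured[OF e] pieces_UNIV[OF e] by simp
  also have "\<dots> = insert e (pieces e (Suc ` UNIV))"
    using s image_pieces[of UNIV] by (simp add: shifts_def)
  also have "Suc ` UNIV = - {0}" unfolding greaterThan_0[symmetric] by auto
  finally have image_Y: "s ` Y e = Y e - pieces e {0}"
    using insert_punctured[OF e] pieces_Compl[OF e] pieces_subset[OF e, of "{0}"]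
    by (auto simp: punctured_def)
  have "(s ^^ Suc n) ` Y e = s ` Y e - s ` pieces e {..<n}"
    using Suc.IH Homeo_inj[of s] s by (simp add: image_set_diff shifts_def flip: image_image)
  also have "\<dots> = Y e - pieces e {..<Suc n}"
    unfolding image_Y image_pieces lessThan_Suc_eq_insert_0 by (auto simp: pieces_def)
  finally show ?case .
qed

lemma ex_shift_Y:
  assumes e: "e \<in> E"
  obtains s where "open_homeo (Y e) (Y e - K e 0) s" "s e = e" "\<And>k. s ` K e k = K e (Suc k)"
proof -
  obtain h where h: "open_homeo (punctured e) (punctured e - K e 0) h" "\<And>k. h ` K e k = K e (Suc k)"
    using ex_open_homeo_piece_sequence[OF compact_UNIV invariant piece_sequence_K[OF e]
        piece_sequence_Suc[OF piece_sequence_K[OF e]]] by blast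
  define s where "s = h(e := e)"
  have s_e: "s e = e" by (simp add: s_def)
  have e_notin: "e \<notin> K e k" for k using K_subset[OF e] by (auto simp: punctured_def)
  have "open_homeo (punctured e) (punctured e - K e 0) s"
    by (rule open_homeo_cong[OF h(1)]) (auto simp: s_def punctured_def)
  moreover have "insert e (punctured e - K e 0) = Y e - K e 0"
    using insert_punctured[OF e] e_notin[of 0] by auto
  moreover have "clopen (Y e - K e 0)" using clopen_Y clopen_K[OF e] by auto
  ultimately have "open_homeo (insert e (punctured e)) (insert (s e) (punctured e - K e 0)) s"
    using clopen_Y insert_punctured[OF e]
    by (intro open_homeo_insert)
      (auto simp: s_e punctured_def intro: closed_imp_compact[OF compact_UNIV])
  then have "open_homeo (Y e) (Y e - K e 0) s"
    using \<open>insert e (punctured e - K e 0) = Y e - K e 0\<close> insert_punctured[OF e] by (simp add: s_e)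
  moreover have "s ` K e k = K e (Suc k)" for k
    unfolding h(2)[symmetric] using e_notin by (intro image_cong) (auto simp: s_def)
  ultimately show thesis using that[of s] s_e by simp
qed

lemma ex_shifts:
  assumes e: "e \<in> E" and e': "e' \<in> E" and ne: "e \<noteq> e'"
  obtains s where "shifts e s" "s \<in> supported (Y e \<union> Y e')"
proof -
  obtain s where s: "open_homeo (Y e) (Y e - K e 0) s" "s e = e" "\<And>k. s ` K e k = K e (Suc k)"
    by (rule ex_shift_Y[OF e]) (rule that)
  obtain s' where s': "open_homeo (Y e') (Y e' - K e' 0) s'"
    by (rule ex_shift_Y[OF e']) (rule that)
  obtain q where q: "open_homeo (K e' 0) (K e 0) q"
    using ex_open_homeo_singleton[OF compact_UNIV invariant clopen_K[OF e'] K_Int_C[OF e']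
        clopen_K[OF e] K_Int_C[OF e]] by blast
  have K_Y: "K e k \<subseteq> Y e" "K e' k \<subseteq> Y e'" for k
    using K_subset[OF e] K_subset[OF e'] by (auto simp: punctured_def)
  have disj: "Y e \<inter> Y e' = {}" using Y_disjoint[OF ne] .
  define p where "p x = (if x \<in> K e' 0 then q x else inv_into (Y e') s' x)" for x
  define F where "F x = (if x \<in> Y e then s x else p x)" for x
  have "open_homeo (K e' 0 \<union> (Y e' - K e' 0)) (K e 0 \<union> Y e') p"
    unfolding p_def
    by (rule open_homeo_Un[OF q open_homeo_inv_into[OF s']]) (use K_Y(1)[of 0] disj in auto)
  then have "open_homeo (Y e') (K e 0 \<union> Y e') p" using K_Y(2) by (simp add: Un_absorb1)
  then have "open_homeo (Y e \<union> Y e') (Y e - K e 0 \<union> (K e 0 \<union> Y e')) F"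
    unfolding F_def by (rule open_homeo_Un[OF s(1)]) (use disj in auto)
  moreover have "Y e - K e 0 \<union> (K e 0 \<union> Y e') = Y e \<union> Y e'" using K_Y(1) by auto
  ultimately have F: "(\<lambda>x. if x \<in> Y e \<union> Y e' then F x else x) \<in> supported (Y e \<union> Y e')"
    using clopen_Y by (intro extend_by_id_supported) auto
  have F_s: "(if x \<in> Y e \<union> Y e' then F x else x) = s x" if "x \<in> Y e" for x
    using that by (simp add: F_def)
  have "(\<lambda>x. if x \<in> Y e \<union> Y e' then F x else x) ` K e k = K e (Suc k)" for k
    unfolding s(3)[symmetric] using F_s K_Y(1) by (intro image_cong) auto
  then have "shifts e (\<lambda>x. if x \<in> Y e \<union> Y e' then F x else x)"
    using supportedD(1)[OF F] F_s[OF Y_mem[OF e]] s(2) by (simp add: shifts_def)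
  then show thesis using that F by blast
qed

lemma ex_shifted_image_subset:
  assumes e: "e \<in> E" and h: "h \<in> carrier Homeo" "h e = e" and s: "shifts e s"
  obtains k where "h ` (s ^^ k) ` Y e \<subseteq> Y e" "(Y e - h ` (s ^^ k) ` Y e) \<inter> C \<noteq> {}"
proof -
  have "open (h -` Y e)" "e \<in> h -` Y e"
    using Homeo_open_vimage[OF h(1)] clopen_Y h(2) Y_mem[OF e] by auto
  then have "\<forall>\<^sub>F j in sequentially. K e j \<subseteq> h -` Y e" by (rule eventually_K_subset[OF e])
  then obtain n where n: "\<And>j. n \<le> j \<Longrightarrow> K e j \<subseteq> h -` Y e"
    unfolding eventually_sequentially by blast
  have "h x \<in> Y e" if "x \<in> Y e - pieces e {..<Suc n}" for x
  proof (cases "x = e")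
    case False
    then have "x \<in> pieces e UNIV" using that pieces_UNIV[OF e] by (simp add: punctured_def)
    then obtain j where "x \<in> K e j" by (auto simp: pieces_def)
    moreover from this have "n \<le> j" using that by (auto simp: pieces_def less_Suc_eq)
    ultimately show ?thesis using n by blast
  qed (use h(2) Y_mem[OF e] in simp)
  then have "h ` (s ^^ Suc n) ` Y e \<subseteq> Y e" unfolding shifts_image_Y[OF e s] by blast
  moreover have "h (pt e n) \<in> (Y e - h ` (s ^^ Suc n) ` Y e) \<inter> C"
  proof -
    have "h (pt e n) \<in> Y e" using n[of n] pt_mem(1)[OF e, of n] by auto
    moreover have "pt e n \<in> pieces e {..<Suc n}" using pt_mem_pieces_iff[OF e] by simp
    ultimately show ?thesis
      using Homeo_mem_C_iff[OF h(1)] pt_mem(2)[OF e] Homeo_inj[OF h(1)]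
      unfolding shifts_image_Y[OF e s] by (auto simp: inj_image_mem_iff)
  qed
  ultimately show thesis using that by blast
qed

lemma ex_open_homeo_initial_pieces:
  assumes e: "e \<in> E" and Z: "clopen Z" "Z \<inter> E = {}" "Z \<inter> C \<noteq> {}"
  obtains m v where "open_homeo (pieces e {..<m}) Z v"
proof -
  have "finite (Z \<inter> C)" using finite_Int_C Z by blast
  then obtain n where n: "card (Z \<inter> C) = Suc n" using Z(3) by (metis card_eq_0_iff not0_implies_Suc)
  have "card (pieces e {..<Suc n} \<inter> C) = Suc n"
    using inj_pt[OF e] by (simp add: pieces_Int_C[OF e] card_image inj_on_subset)
  then obtain v where "open_homeo (pieces e {..<Suc n}) Z v"
    using ex_open_homeo_card[OF compact_UNIV invariant _ Z(1) _ n]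
      open_pieces[OF e] closed_pieces[OF e]
    by blast
  then show thesis using that by blast
qed

text \<open>Both \<open>h s\<^sup>k\<close> and \<open>s\<^sup>m\<close> map \<open>Y e\<close> into itself, and \<open>m\<close> is chosen so that their images miss
  the same number of points of \<open>C\<close>.\<close>
lemma ex_supported_Y_shift_eq:
  assumes e: "e \<in> E" and h: "h \<in> carrier Homeo" "h e = e" and s: "shifts e s"
  obtains u m k where "u \<in> supported (Y e)" "\<And>x. x \<in> Y e \<Longrightarrow> u ((s ^^ m) x) = h ((s ^^ k) x)"
proof -
  obtain k where k: "h ` (s ^^ k) ` Y e \<subseteq> Y e" "(Y e - h ` (s ^^ k) ` Y e) \<inter> C \<noteq> {}"
    using ex_shifted_image_subset[OF e h s] by blast
  have s_pow: "s ^^ n \<in> carrier Homeo" for n using s by (simp add: shifts_def Homeo_funpow)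
  define b where "b = h \<circ> s ^^ k"
  have b: "b \<in> carrier Homeo" unfolding b_def using h(1) s_pow by (rule Homeo.m_closed)
  have image_b: "b ` Y e \<subseteq> Y e" "(Y e - b ` Y e) \<inter> C \<noteq> {}"
    using k by (simp_all add: b_def image_comp)
  have "(s ^^ k) e = e" using s by (induction k) (auto simp: shifts_def)
  then have "e \<in> b ` Y e"
    using h(2) Y_mem[OF e] by (auto simp: b_def image_iff intro!: bexI[of _ e])
  then have "(Y e - b ` Y e) \<inter> E = {}" using mem_E_Y_eq by auto
  moreover have "clopen (Y e - b ` Y e)"
    using Homeo_open_image[OF b] Homeo_closed_image[OF b] clopen_Y by auto
  ultimately obtain m v where v: "open_homeo (pieces e {..<m}) (Y e - b ` Y e) v"
    using ex_open_homeo_initial_pieces[OF e] image_b(2) by blast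
  have image_s: "(s ^^ m) ` Y e \<subseteq> Y e" "Y e - (s ^^ m) ` Y e = pieces e {..<m}"
    unfolding shifts_image_Y[OF e s] using pieces_subset[OF e, of "{..<m}"]
    by (auto simp: punctured_def)
  obtain u where "u \<in> supported (Y e)" "\<And>x. x \<in> Y e \<Longrightarrow> u ((s ^^ m) x) = b x"
    using ex_supported_comp_eq[OF _ _ s_pow image_s(1) b image_b(1) v[folded image_s(2)]] clopen_Y
    by blast
  then show thesis by (intro that[of u m k]) (simp_all add: b_def)
qed

lemma ex_straightening_on_Y:
  assumes e: "e \<in> E" and H: "subgroup H Homeo" "supported (Y e) \<subseteq> H"
    and s: "s \<in> H" "shifts e s" "s \<in> supported (Y e \<union> Y e0)" and h: "h \<in> carrier Homeo" "h e = e"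
  obtains a b where "a \<in> H" "b \<in> H" "a \<in> supported (Y e \<union> Y e0)" "b \<in> supported (Y e \<union> Y e0)"
    "\<And>x. x \<in> Y e \<Longrightarrow> a x = h (b x)"
proof -
  obtain u m k where u: "u \<in> supported (Y e)" "\<And>x. x \<in> Y e \<Longrightarrow> u ((s ^^ m) x) = h ((s ^^ k) x)"
    using ex_supported_Y_shift_eq[OF e h s(2)] by blast
  show thesis
  proof (rule that[of "u \<circ> s ^^ m" "s ^^ k"])
    show "u \<circ> s ^^ m \<in> H" "s ^^ k \<in> H"
      using u(1) H(2) s(1) subgroup_Homeo_comp[OF H(1)] subgroup_Homeo_funpow[OF H(1)] by blast+
    have "u \<in> supported (Y e \<union> Y e0)" using u(1) supported_mono[of "Y e"] by blast
    then show "u \<circ> s ^^ m \<in> supported (Y e \<union> Y e0)" "s ^^ k \<in> supported (Y e \<union> Y e0)"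
      using s(3) by (simp_all add: supported_comp supported_funpow)
  qed (use u(2) in simp)
qed

lemma subgroup_contains_fixing_E:
  assumes e0: "e0 \<in> E" and H: "subgroup H Homeo"
    and local: "\<And>e. e \<in> E \<Longrightarrow> supported (Y e) \<subseteq> H"
    and shift: "\<And>e. e \<in> E - {e0} \<Longrightarrow> \<exists>s\<in>H. shifts e s \<and> s \<in> supported (Y e \<union> Y e0)"
    and F: "finite F" "F \<subseteq> E - {e0}"
    and h: "h \<in> supported (Y e0 \<union> (\<Union>e\<in>F. Y e))" "\<And>e. e \<in> F \<Longrightarrow> h e = e"
  shows "h \<in> H"
  using F h
proof (induction F arbitrary: h rule: finite_induct)
  case empty
  then show ?case using local[OF e0] by auto
next
  case (insert e F)
  then have e: "e \<in> E" "e \<in> E - {e0}" by auto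
  have h: "h \<in> carrier Homeo" "h e = e"
    using supportedD(1)[OF insert.prems(2)] insert.prems(3) by auto
  obtain s where "s \<in> H" "shifts e s" "s \<in> supported (Y e \<union> Y e0)" using shift[OF e(2)] by blast
  then obtain a b where ab_H: "a \<in> H" "b \<in> H"
    and ab: "a \<in> supported (Y e \<union> Y e0)" "b \<in> supported (Y e \<union> Y e0)"
    and a_eq: "\<And>x. x \<in> Y e \<Longrightarrow> a x = h (b x)"
    using ex_straightening_on_Y[OF e(1) H local[OF e(1)] _ _ _ h] by blast
  have a: "a \<in> carrier Homeo" and b: "b \<in> carrier Homeo" using ab supportedD(1) by blast+
  define h' where "h' = inv\<^bsub>Homeo\<^esub> a \<circ> h \<circ> b"
  have fixed: "h' x = x" if "x \<in> Y e" for x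
    using a_eq[OF that] Homeo_inv_apply(2)[OF a, of x] by (simp add: h'_def)
  have outside: "h' x = x" if "x \<notin> Y e \<union> Y e0" "h x = x" for x
    using that supportedD(2)[OF supported_inv[OF ab(1)]] supportedD(2)[OF ab(2)]
    by (simp add: h'_def)
  have "h' \<in> H"
  proof (rule insert.IH)
    show "F \<subseteq> E - {e0}" using insert.prems(1) by simp
    show "h' \<in> supported (Y e0 \<union> (\<Union>e\<in>F. Y e))"
      using fixed outside supportedD(2)[OF insert.prems(2)] a b h(1)
      by (auto simp: supported_def h'_def[symmetric]) (auto simp: h'_def)
    show "h' e' = e'" if "e' \<in> F" for e'
      using that insert.hyps insert.prems(1,3) mem_E_Y_eq[of e' e] mem_E_Y_eq[of e' e0]
      by (intro outside) auto
  qed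
  then have "a \<circ> (h' \<circ> inv\<^bsub>Homeo\<^esub> b) \<in> H"
    using ab_H by (intro subgroup_Homeo_comp[OF H] subgroup.m_inv_closed[OF H])
  moreover have "a \<circ> (h' \<circ> inv\<^bsub>Homeo\<^esub> b) = h"
    by (simp add: h'_def fun_eq_iff Homeo_inv_apply a b)
  ultimately show ?case by simp
qed

lemma carrier_subset_subgroup:
  assumes e0: "e0 \<in> E" and H: "subgroup H Homeo"
    and local: "\<And>e. e \<in> E \<Longrightarrow> supported (Y e) \<subseteq> H"
    and shift: "\<And>e. e \<in> E - {e0} \<Longrightarrow> \<exists>s\<in>H. shifts e s \<and> s \<in> supported (Y e \<union> Y e0)"
    and representative: "\<And>h. h \<in> carrier Homeo \<Longrightarrow> \<exists>r\<in>H. \<forall>e\<in>E. r e = h e"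
  shows "carrier Homeo \<subseteq> H"
proof
  fix h :: "'a \<Rightarrow> 'a" assume h: "h \<in> carrier Homeo"
  then obtain r where r: "r \<in> H" "\<And>e. e \<in> E \<Longrightarrow> r e = h e" using representative by blast
  have rH: "r \<in> carrier Homeo" using subgroup.mem_carrier[OF H r(1)] .
  have "Y e0 \<union> (\<Union>e\<in>E - {e0}. Y e) = UNIV"
  proof -
    have "x \<in> Y e0 \<union> (\<Union>e\<in>E - {e0}. Y e)" for x by (rule Y_cover[of x]) auto
    then show ?thesis by blast
  qed
  then have "inv\<^bsub>Homeo\<^esub> r \<circ> h \<in> supported (Y e0 \<union> (\<Union>e\<in>E - {e0}. Y e))"
    using h rH by (simp add: supported_def)
  moreover have "(inv\<^bsub>Homeo\<^esub> r \<circ> h) e = e" if "e \<in> E - {e0}" for e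
    using r(2)[of e] Homeo_inv_apply(2)[OF rH, of e] that by simp
  ultimately have "inv\<^bsub>Homeo\<^esub> r \<circ> h \<in> H"
    using finite_E by (intro subgroup_contains_fixing_E[OF e0 H local shift, of "E - {e0}"]) auto
  then have "r \<circ> (inv\<^bsub>Homeo\<^esub> r \<circ> h) \<in> H" by (rule subgroup_Homeo_comp[OF H r(1)])
  moreover have "r \<circ> (inv\<^bsub>Homeo\<^esub> r \<circ> h) = h" by (simp add: fun_eq_iff Homeo_inv_apply rH)
  ultimately show "h \<in> H" by simp
qed

lemma ex_finite_representatives:
  obtains R where "finite R" "R \<subseteq> carrier Homeo"
    "\<And>h. h \<in> carrier Homeo \<Longrightarrow> \<exists>r\<in>R. \<forall>e\<in>E. r e = h e"
proof -
  define perms where "perms = (\<lambda>g. restrict g E) ` (carrier Homeo :: ('a \<Rightarrow> 'a) set)"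
  have "perms \<subseteq> E \<rightarrow>\<^sub>E E" using Homeo_mem_E_iff by (auto simp: perms_def)
  then have "finite perms" using finite_PiE[OF finite_E finite_E] finite_subset by blast
  then obtain R where R: "R \<subseteq> carrier Homeo" "finite R" "perms = (\<lambda>g. restrict g E) ` R"
    using finite_subset_image[of perms "\<lambda>g. restrict g E" "carrier Homeo"]
    unfolding perms_def by blast
  show thesis
  proof (rule that[OF R(2,1)])
    fix h :: "'a \<Rightarrow> 'a" assume "h \<in> carrier Homeo"
    then have "restrict h E \<in> (\<lambda>g. restrict g E) ` R" using R(3) by (auto simp: perms_def)
    then obtain r where "r \<in> R" "restrict r E = restrict h E" by force
    then show "\<exists>r\<in>R. \<forall>e\<in>E. r e = h e" by (metis restrict_apply')
  qed
qed

lemma SB_generated_Homeo: "SB_generated (Homeo :: ('a \<Rightarrow> 'a) monoid)"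
proof -
  obtain e0 where e0: "e0 \<in> E" using Max_E_mem by blast
  have "\<exists>s. shifts e s \<and> s \<in> supported (Y e \<union> Y e0)" if "e \<in> E - {e0}" for e
    using ex_shifts[OF _ e0, of e] that by blast
  then obtain s where s: "\<And>e. e \<in> E - {e0} \<Longrightarrow> shifts e (s e) \<and> s e \<in> supported (Y e \<union> Y e0)"
    by metis
  obtain R where R: "finite R" "R \<subseteq> carrier Homeo"
    "\<And>h. h \<in> carrier Homeo \<Longrightarrow> \<exists>r\<in>R. \<forall>e\<in>E. r e = h e"
    using ex_finite_representatives by blast
  define A where "A = (\<Union>e\<in>E. supported (Y e)) \<union> s ` (E - {e0}) \<union> R"
  have "strongly_bounded Homeo (\<Union>e\<in>E. supported (Y e))"
    using finite_E strongly_bounded_supported_Y by (rule Homeo.strongly_bounded_UN)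
  moreover have "strongly_bounded Homeo (s ` (E - {e0}))"
    by (rule Homeo.strongly_bounded_finite) (use finite_E s in \<open>auto simp: shifts_def\<close>)
  moreover have "strongly_bounded Homeo R" using R(1,2) by (rule Homeo.strongly_bounded_finite)
  ultimately have A: "strongly_bounded Homeo A"
    unfolding A_def by (intro Homeo.strongly_bounded_Un)
  then have A_carrier: "A \<subseteq> carrier Homeo" by (simp add: strongly_bounded_def)
  have incl: "A \<subseteq> generate Homeo A" by (auto intro: generate.incl)
  have "carrier Homeo \<subseteq> generate Homeo A"
  proof (rule carrier_subset_subgroup[OF e0 Homeo.generate_is_subgroup[OF A_carrier]])
    show "supported (Y e) \<subseteq> generate Homeo A" if "e \<in> E" for e
      using incl that unfolding A_def by blast
    show "\<exists>g\<in>generate Homeo A. shifts e g \<and> g \<in> supported (Y e \<union> Y e0)" if "e \<in> E - {e0}" for e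
      using incl s[OF that] that unfolding A_def by blast
    show "\<exists>r\<in>generate Homeo A. \<forall>e\<in>E. r e = h e" if "h \<in> carrier Homeo" for h
      using incl R(3)[OF that] unfolding A_def by blast
  qed
  then have "generate Homeo A = carrier Homeo" using Homeo.generate_incl[OF A_carrier] by blast
  then show ?thesis using A unfolding SB_generated_def by blast
qed

end

lemma last_derivative_empty:
  fixes f :: "'i::wellorder \<Rightarrow> 'a::{wellorder, linorder_topology} set"
  assumes f: "cb_deriv_seq f" and r: "cb_rank_is f r"
  shows "f r = {}"
proof (rule ccontr)
  assume ne: "f r \<noteq> {}"
  obtain s where "wo_succ r s" "f s = f r" using r unfolding cb_rank_is_def by blast
  then have perfect: "f r = {x. x islimpt f r}" using f unfolding cb_deriv_seq_def by metis
  define m where "m = (LEAST x. x \<in> f r)"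
  have "m \<in> f r" using ne unfolding m_def by (auto intro: LeastI)
  then have "m islimpt f r" using perfect by blast
  then obtain x where "x \<in> f r" "x < m"
    using clopen_atMost[of m] by (metis islimptE atMost_iff order_refl order_le_less)
  then show False using not_less_Least unfolding m_def by blast
qed

theorem theorem6p1:
  fixes f :: "'i::wellorder \<Rightarrow> 'a::{wellorder, linorder_topology} set"
    and b :: 'i
  assumes "compact (UNIV :: 'a set)"
    and "cb_deriv_seq f"
    and "limit_capacity_is f b"
    and "\<exists>c. wo_succ c b"
  shows "SB_generated (Homeo :: ('a \<Rightarrow> 'a) monoid)"
proof -
  obtain c r where c_b: "wo_succ c b" and b_r: "wo_succ b r" and rank: "cb_rank_is f r"
    using assms(3,4) unfolding limit_capacity_is_def by blast
  have derived: "f j = {x. x islimpt f i}" if "wo_succ i j" for i j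
    using assms(2) that unfolding cb_deriv_seq_def by blast
  have empty: "f r = {}" using last_derivative_empty[OF assms(2) rank] .
  interpret finite_derived_set "f c"
  proof
    show "homeo_invariant (f c)" using homeo_invariant_cb_deriv[OF assms(2)] .
    have "finite (UNIV \<inter> f b)"
      using derived[OF b_r] empty by (intro finite_not_islimpt_in_compact assms(1)) blast
    then show "finite {x. x islimpt f c}" by (simp add: derived[OF c_b, symmetric])
    have "f b \<noteq> {}" using b_r rank empty unfolding cb_rank_is_def wo_succ_def by (metis leD)
    then show "\<exists>x. x islimpt f c" by (simp add: derived[OF c_b])
  qed (rule assms(1))
  show ?thesis by (rule SB_generated_Homeo)
qed

end
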